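(* With the notation of the context, consider the ODE on functions $h\colon\mathsf{X}\to\mathbb{R}$ $$\frac{d}{d\zeta}h^\circ_\zeta=\mathcal{V}(h^\circ_\zeta),\qquad \zeta\in\mathbb{R},$$ with boundary condition $h^\circ_0\equiv 0$, where $\mathcal{V}(h)=\mathcal{H}^\circ(P_h)$, and where, for each irreducible and aperiodic transition matrix $P$ on $\mathsf{X}$, the function $H^\circ=\mathcal{H}^\circ(P)$ is defined by $$H^\circ(x)=\sum_{x'}\bigl[Z(x,x')-Z(x^\circ,x')\bigr]\,\mathcal{U}(x'),\quad x\in\mathsf{X},\qquad Z=[I-P+1\otimes\pi]^{-1},$$ with $\pi$ the invariant pmf of $P$. Then the solution to this ODE exists, and the resulting functions $\{h^\circ_\zeta:\zeta\in\mathbb{R}\}$ coincide with the relative value functions $\{h^*_\zeta:\zeta\in\mathbb{R}\}$ (normalized by $h^*_\zeta(x^\circ)=0$). Consequently, $\check{P}_\zeta=P_{h^\circ_\zeta}$ for each $\zeta$.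
   Context: State space and nominal model: $\mathsf{X}=\mathsf{X}_{\sf u}\times\mathsf{X}_{\sf n}$ is a product of two finite sets; write $x=(x_u,x_n)$. $P_0$ is an irreducible and aperiodic transition matrix on $\mathsf{X}$ of the form $P_0(x,x')=R_0(x,x'_u)Q_0(x,x'_n)$, where for each $x$, $R_0(x,\cdot)$ is a pmf on $\mathsf{X}_{\sf u}$ and $Q_0(x,\cdot)$ is a pmf on $\mathsf{X}_{\sf n}$. $\mathcal{U}\colon\mathsf{X}\to\mathbb{R}$ is a given function and $x^\circ\in\mathsf{X}$ is a fixed state. Functions on $\mathsf{X}$ are column vectors, pmfs are row vectors, and $1\otimes\pi$ is the matrix each of whose rows equals $\pi$. Admissible transition matrices: $P(x,x')=R(x,x'_u)Q_0(x,x'_n)$ with $Q_0$ fixed and $R$ a randomized decision rule (each $R(x,\cdot)$ a pmf on $\mathsf{X}_{\sf u}$). The one-step reward is $$w(x,R)=\zeta\,\mathcal{U}(x)-c_{\rm KL}(x,R),\qquad c_{\rm KL}(x,R)=\sum_{x'}P(x,x')\log\frac{P(x,x')}{P_0(x,x')}=\sum_{x'_u}R(x,x'_u)\log\frac{R(x,x'_u)}{R_0(x,x'_u)},$$ with the usual conventions for relative entropy ($0\log 0=0$, and value $+\infty$ without absolute continuity). Average-reward optimality equation (AROE): for each $\zeta\in\mathbb{R}$, the optimal average reward $\eta^*(\zeta)$ and the relative value function $h^*_\zeta\colon\mathsf{X}\to\mathbb{R}$ satisfy $$\max_R\Bigl\{w(x,R)+\sum_{x'}P(x,x')h^*_\zeta(x')\Bigr\}=h^*_\zeta(x)+\eta^*(\zeta),\quad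 x\in\mathsf{X},$$ with $P$ depending on $R$ via $P(x,x')=R(x,x'_u)Q_0(x,x'_n)$, and with the normalization $h^*_\zeta(x^\circ)=0$. The maximizer defines the optimal transition matrix $\check{P}_\zeta$, which is equivalently the maximizer $P$ in $\max\{\zeta\pi(\mathcal{U})-K(P\|P_0):\pi P=\pi\}$ over admissible $P$ and pmfs $\pi$, where $\pi(\mathcal{U})=\sum_x\pi(x)\mathcal{U}(x)$ and $K(P\|P_0)=\sum_{x,x'}\pi(x)P(x,x')\log\frac{P(x,x')}{P_0(x,x')}$. Twisted matrices: for $h\colon\mathsf{X}\to\mathbb{R}$, $$P_h(x,x')=P_0(x,x')\exp\bigl(h(x'_u\mid x)-\Lambda_h(x)\bigr),\qquad h(x'_u\mid x)=\sum_{x'_n}Q_0(x,x'_n)h(x'_u,x'_n),$$ $$\Lambda_h(x)=\log\Bigl(\sum_{x'}P_0(x,x')\exp\bigl(h(x'_u\mid x)\bigr)\Bigr).$$ *)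

theory Defs
  imports "HOL-Probability.Probability"
begin

text \<open>
  The state space is the product type \<open>'u \<times> 'n\<close> of two finite types. Functions on it are
  vectors \<open>real ^ ('u \<times> 'n)\<close>; the \<open>(x, x')\<close> entry of a matrix \<open>P\<close> is \<open>P $ x $ x'\<close>.
  A randomized decision rule is a map \<open>R :: 'u \<times> 'n \<Rightarrow> 'u pmf\<close>.
\<close>

definition transition_matrix ::
  "(('u::finite \<times> 'n::finite) \<Rightarrow> 'n pmf) \<Rightarrow> ('u \<times> 'n \<Rightarrow> 'u pmf) \<Rightarrow> real ^ ('u \<times> 'n) ^ ('u \<times> 'n)"
  where "transition_matrix Q R = (\<chi> x x'. pmf (R x) (fst x') * pmf (Q x) (snd x'))"

text \<open>On \<open>real ^ 'a ^ 'a\<close> the library's \<open>^\<close> is the componentwise power.\<close>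

primrec matrix_power :: "real ^ 'a ^ 'a \<Rightarrow> nat \<Rightarrow> real ^ 'a ^ 'a::finite" where
  "matrix_power P 0 = mat 1"
| "matrix_power P (Suc k) = P ** matrix_power P k"

definition irreducible_matrix :: "real ^ 'a ^ 'a::finite \<Rightarrow> bool" where
  "irreducible_matrix P \<longleftrightarrow> (\<forall>x y. \<exists>k. matrix_power P k $ x $ y > 0)"

definition aperiodic_matrix :: "real ^ 'a ^ 'a::finite \<Rightarrow> bool" where
  "aperiodic_matrix P \<longleftrightarrow> (\<forall>x. Gcd {k. k \<ge> 1 \<and> matrix_power P k $ x $ x > 0} = 1)"

definition pmf_vec :: "'a::finite pmf \<Rightarrow> real ^ 'a" where
  "pmf_vec \<pi> = (\<chi> x. pmf \<pi> x)"

definition invariant_for :: "real ^ 'a ^ 'a \<Rightarrow> 'a::finite pmf \<Rightarrow> bool" where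
  "invariant_for P \<pi> \<longleftrightarrow> pmf_vec \<pi> v* P = pmf_vec \<pi>"

text \<open>The value is meaningful when \<open>P\<close> is an irreducible transition matrix, since then the
  invariant pmf exists and is unique.\<close>

definition invariant_pmf :: "real ^ 'a ^ 'a \<Rightarrow> 'a::finite pmf" where
  "invariant_pmf P = (THE \<pi>. invariant_for P \<pi>)"


subsection \<open>Rewards and the optimality equation\<close>

text \<open>The summand \<open>p log (p / q)\<close> of relative entropy, with its usual extended-real conventions.\<close>

definition rel_entropy_term :: "real \<Rightarrow> real \<Rightarrow> ereal" where
  "rel_entropy_term p q =
     (if p = 0 then 0 else if q = 0 then \<infinity> else ereal (p * ln (p / q)))"

definition kl_cost ::
  "(('u::finite \<times> 'n::finite) \<Rightarrow> 'n pmf) \<Rightarrow> ('u \<times> 'n \<Rightarrow> 'u pmf) \<Rightarrow> 'u \<times> 'n \<Rightarrow> ('u \<times> 'n \<Rightarrow> 'u pmf) \<Rightarrow> ereal"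
  where "kl_cost Q\<^sub>0 R\<^sub>0 x R =
    (\<Sum>x'\<in>UNIV. rel_entropy_term (transition_matrix Q\<^sub>0 R $ x $ x') (transition_matrix Q\<^sub>0 R\<^sub>0 $ x $ x'))"

definition one_step_reward ::
  "(('u::finite \<times> 'n::finite) \<Rightarrow> 'n pmf) \<Rightarrow> ('u \<times> 'n \<Rightarrow> 'u pmf) \<Rightarrow> real ^ ('u \<times> 'n) \<Rightarrow> real
    \<Rightarrow> 'u \<times> 'n \<Rightarrow> ('u \<times> 'n \<Rightarrow> 'u pmf) \<Rightarrow> ereal"
  where "one_step_reward Q\<^sub>0 R\<^sub>0 U \<zeta> x R = ereal (\<zeta> * U $ x) - kl_cost Q\<^sub>0 R\<^sub>0 x R"

text \<open>The rate \<open>K(P \<parallel> P\<^sub>0)\<close>; it depends on the chosen invariant pmf \<open>\<pi>\<close>. In type \<open>ereal\<close> we have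
  \<open>0 * \<infinity> = 0\<close>, so rows outside the support of \<open>\<pi>\<close> do not contribute.\<close>

definition kl_rate :: "real ^ 'a ^ 'a \<Rightarrow> real ^ 'a ^ 'a \<Rightarrow> 'a::finite pmf \<Rightarrow> ereal" where
  "kl_rate P P\<^sub>0 \<pi> =
     (\<Sum>x\<in>UNIV. \<Sum>x'\<in>UNIV. ereal (pmf \<pi> x) * rel_entropy_term (P $ x $ x') (P\<^sub>0 $ x $ x'))"

definition steady_state_reward ::
  "real ^ 'a ^ 'a \<Rightarrow> real ^ 'a \<Rightarrow> real \<Rightarrow> (real ^ 'a ^ 'a) \<times> 'a::finite pmf \<Rightarrow> ereal"
  where "steady_state_reward P\<^sub>0 U \<zeta> =
    (\<lambda>(P, \<pi>). ereal (\<zeta> * (\<Sum>x\<in>UNIV. pmf \<pi> x * U $ x)) - kl_rate P P\<^sub>0 \<pi>)"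

definition admissible_pair ::
  "(('u::finite \<times> 'n::finite) \<Rightarrow> 'n pmf) \<Rightarrow> (real ^ ('u \<times> 'n) ^ ('u \<times> 'n)) \<times> ('u \<times> 'n) pmf \<Rightarrow> bool"
  where "admissible_pair Q\<^sub>0 = (\<lambda>(P, \<pi>). (\<exists>R. P = transition_matrix Q\<^sub>0 R) \<and> invariant_for P \<pi>)"

definition optimal_average_reward ::
  "(('u::finite \<times> 'n::finite) \<Rightarrow> 'n pmf) \<Rightarrow> ('u \<times> 'n \<Rightarrow> 'u pmf) \<Rightarrow> real ^ ('u \<times> 'n) \<Rightarrow> real \<Rightarrow> ereal"
  where "optimal_average_reward Q\<^sub>0 R\<^sub>0 U \<zeta> =
    (SUP p \<in> {p. admissible_pair Q\<^sub>0 p}. steady_state_reward (transition_matrix Q\<^sub>0 R\<^sub>0) U \<zeta> p)"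

definition aroe_objective ::
  "(('u::finite \<times> 'n::finite) \<Rightarrow> 'n pmf) \<Rightarrow> ('u \<times> 'n \<Rightarrow> 'u pmf) \<Rightarrow> real ^ ('u \<times> 'n) \<Rightarrow> real
    \<Rightarrow> real ^ ('u \<times> 'n) \<Rightarrow> 'u \<times> 'n \<Rightarrow> ('u \<times> 'n \<Rightarrow> 'u pmf) \<Rightarrow> ereal"
  where "aroe_objective Q\<^sub>0 R\<^sub>0 U \<zeta> h x R =
    one_step_reward Q\<^sub>0 R\<^sub>0 U \<zeta> x R + ereal (\<Sum>x'\<in>UNIV. transition_matrix Q\<^sub>0 R $ x $ x' * h $ x')"

text \<open>The maximum in the optimality equation ranges over all decision rules, hence over the whole
  type; \<open>is_arg_max\<close> makes its attainment part of the equation.\<close>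

definition solves_aroe ::
  "(('u::finite \<times> 'n::finite) \<Rightarrow> 'n pmf) \<Rightarrow> ('u \<times> 'n \<Rightarrow> 'u pmf) \<Rightarrow> real ^ ('u \<times> 'n) \<Rightarrow> real
    \<Rightarrow> real ^ ('u \<times> 'n) \<Rightarrow> ereal \<Rightarrow> bool"
  where "solves_aroe Q\<^sub>0 R\<^sub>0 U \<zeta> h \<eta> \<longleftrightarrow>
    (\<forall>x. \<exists>R. is_arg_max (aroe_objective Q\<^sub>0 R\<^sub>0 U \<zeta> h x) (\<lambda>_. True) R \<and>
             aroe_objective Q\<^sub>0 R\<^sub>0 U \<zeta> h x R = ereal (h $ x) + \<eta>)"

definition relative_value_function ::
  "(('u::finite \<times> 'n::finite) \<Rightarrow> 'n pmf) \<Rightarrow> ('u \<times> 'n \<Rightarrow> 'u pmf) \<Rightarrow> real ^ ('u \<times> 'n) \<Rightarrow> 'u \<times> 'n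
    \<Rightarrow> real \<Rightarrow> real ^ ('u \<times> 'n) \<Rightarrow> bool"
  where "relative_value_function Q\<^sub>0 R\<^sub>0 U x\<^sub>0 \<zeta> h \<longleftrightarrow>
    solves_aroe Q\<^sub>0 R\<^sub>0 U \<zeta> h (optimal_average_reward Q\<^sub>0 R\<^sub>0 U \<zeta>) \<and> h $ x\<^sub>0 = 0"

definition optimal_transition_matrix ::
  "(('u::finite \<times> 'n::finite) \<Rightarrow> 'n pmf) \<Rightarrow> ('u \<times> 'n \<Rightarrow> 'u pmf) \<Rightarrow> real ^ ('u \<times> 'n) \<Rightarrow> 'u \<times> 'n
    \<Rightarrow> real \<Rightarrow> real ^ ('u \<times> 'n) ^ ('u \<times> 'n) \<Rightarrow> bool"
  where "optimal_transition_matrix Q\<^sub>0 R\<^sub>0 U x\<^sub>0 \<zeta> P \<longleftrightarrow>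
    (\<exists>h R. relative_value_function Q\<^sub>0 R\<^sub>0 U x\<^sub>0 \<zeta> h \<and> P = transition_matrix Q\<^sub>0 R \<and>
           (\<forall>x. is_arg_max (aroe_objective Q\<^sub>0 R\<^sub>0 U \<zeta> h x) (\<lambda>_. True) R))"


subsection \<open>Twisted matrices and the vector field\<close>

definition cond_fun ::
  "(('u::finite \<times> 'n::finite) \<Rightarrow> 'n pmf) \<Rightarrow> real ^ ('u \<times> 'n) \<Rightarrow> 'u \<times> 'n \<Rightarrow> 'u \<Rightarrow> real"
  where "cond_fun Q\<^sub>0 h x u = (\<Sum>n\<in>UNIV. pmf (Q\<^sub>0 x) n * h $ (u, n))"

definition log_normalizer ::
  "(('u::finite \<times> 'n::finite) \<Rightarrow> 'n pmf) \<Rightarrow> ('u \<times> 'n \<Rightarrow> 'u pmf) \<Rightarrow> real ^ ('u \<times> 'n) \<Rightarrow> 'u \<times> 'n \<Rightarrow> real"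
  where "log_normalizer Q\<^sub>0 R\<^sub>0 h x =
    ln (\<Sum>x'\<in>UNIV. transition_matrix Q\<^sub>0 R\<^sub>0 $ x $ x' * exp (cond_fun Q\<^sub>0 h x (fst x')))"

definition twisted_matrix ::
  "(('u::finite \<times> 'n::finite) \<Rightarrow> 'n pmf) \<Rightarrow> ('u \<times> 'n \<Rightarrow> 'u pmf) \<Rightarrow> real ^ ('u \<times> 'n)
    \<Rightarrow> real ^ ('u \<times> 'n) ^ ('u \<times> 'n)"
  where "twisted_matrix Q\<^sub>0 R\<^sub>0 h =
    (\<chi> x x'. transition_matrix Q\<^sub>0 R\<^sub>0 $ x $ x'
        * exp (cond_fun Q\<^sub>0 h x (fst x') - log_normalizer Q\<^sub>0 R\<^sub>0 h x))"

definition fundamental_matrix :: "real ^ 'a ^ 'a \<Rightarrow> real ^ 'a ^ 'a::finite" where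
  "fundamental_matrix P = matrix_inv (mat 1 - P + (\<chi> x x'. pmf (invariant_pmf P) x'))"

text \<open>The map \<open>P \<mapsto> H\<^sup>\<circ>\<close>. It is only meaningful for irreducible aperiodic \<open>P\<close>; every twisted
  matrix has the same support as the nominal one and so inherits these properties.\<close>

definition H_circ :: "real ^ 'a \<Rightarrow> 'a \<Rightarrow> real ^ 'a ^ 'a \<Rightarrow> real ^ 'a::finite" where
  "H_circ U x\<^sub>0 P =
     (\<chi> x. \<Sum>x'\<in>UNIV. (fundamental_matrix P $ x $ x' - fundamental_matrix P $ x\<^sub>0 $ x') * U $ x')"

definition vector_field ::
  "(('u::finite \<times> 'n::finite) \<Rightarrow> 'n pmf) \<Rightarrow> ('u \<times> 'n \<Rightarrow> 'u pmf) \<Rightarrow> real ^ ('u \<times> 'n) \<Rightarrow> 'u \<times> 'n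
    \<Rightarrow> real ^ ('u \<times> 'n) \<Rightarrow> real ^ ('u \<times> 'n)"
  where "vector_field Q\<^sub>0 R\<^sub>0 U x\<^sub>0 h = H_circ U x\<^sub>0 (twisted_matrix Q\<^sub>0 R\<^sub>0 h)"

definition solves_ode ::
  "(('u::finite \<times> 'n::finite) \<Rightarrow> 'n pmf) \<Rightarrow> ('u \<times> 'n \<Rightarrow> 'u pmf) \<Rightarrow> real ^ ('u \<times> 'n) \<Rightarrow> 'u \<times> 'n
    \<Rightarrow> (real \<Rightarrow> real ^ ('u \<times> 'n)) \<Rightarrow> bool"
  where "solves_ode Q\<^sub>0 R\<^sub>0 U x\<^sub>0 h \<longleftrightarrow>
    h 0 = 0 \<and> (\<forall>\<zeta>. (h has_vector_derivative vector_field Q\<^sub>0 R\<^sub>0 U x\<^sub>0 (h \<zeta>)) (at \<zeta>))"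

end

theory Submission
  imports Defs
begin

text \<open>
  By the Gibbs variational formula the maximum in the optimality equation at \<open>x\<close> equals
  \<open>\<zeta> U(x) + \<Lambda>\<^sub>h(x)\<close>, and the only maximizing row is that of the twisted matrix \<open>P\<^sub>h\<close>
  (\<open>aroe_objective_bound\<close>). The optimality equation is therefore \<open>\<Lambda>\<^sub>h + \<zeta> U = h + \<eta>\<close>. Its
  solutions are normalized by \<open>h(x\<^sub>0) = 0\<close>, so the pair \<open>(h, \<eta>)\<close> can be packed into the one vector
  \<open>v = h + \<eta>\<close>, with \<open>\<eta> = v(x\<^sub>0)\<close>, and the equation becomes \<open>F(v) = \<zeta> U\<close> for the map
  \<open>F(v)(x) = v(x) + v(x\<^sub>0) - \<Lambda>\<^sub>v(x)\<close>.

  The map \<open>F\<close> is a bijection of the Euclidean space of functions onto itself (\<open>bij_aroe_map\<close>).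
  It is injective by the maximum principle, because \<open>\<Lambda>\<close> is convex with gradient \<open>P\<^sub>h\<close>. Preimages
  of bounded sets are bounded, because irreducibility of the nominal chain controls the oscillation
  of almost superharmonic functions. Hence the range of \<open>F\<close> is closed, it is open by invariance of
  domain, and so it is the whole space. This produces a solution of the optimality equation for
  every \<open>\<zeta>\<close> at once, as the curve \<open>F\<^sup>-\<^sup>1(\<zeta> U)\<close>.

  The derivative of \<open>F\<close> at \<open>h\<close> is \<open>k \<mapsto> k - P\<^sub>h k + k(x\<^sub>0)\<close>, which is invertible, so the curve is
  differentiable, and its velocity is the preimage of \<open>U\<close> under this operator. The Poisson equation
  for the fundamental matrix identifies that preimage, after normalization at \<open>x\<^sub>0\<close>, with the
  vector field (\<open>normalized_curve_solves_ode\<close>). Conversely, along any solution of the differential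
  equation the derivative of \<open>F(h\<^sub>\<zeta>) - \<zeta> U\<close> is a constant function of the state; a solution hence
  satisfies the optimality equation for all \<open>\<zeta>\<close>, and it is the curve above
  (\<open>ode_solution_unique\<close>).

  Finally, averaging the optimality equation over an invariant pmf \<open>\<pi>\<close> of an admissible \<open>P\<close> shows
  that its steady-state reward is \<open>\<eta>\<close> minus the \<open>\<pi>\<close>-average of the divergence of the rows of \<open>P\<close>
  from those of \<open>P\<^sub>h\<close> (\<open>steady_state_reward_bound\<close>), so \<open>\<eta>\<close> is the optimal average reward and
  \<open>P\<^sub>h\<close> is the only optimizer.
\<close>


section \<open>Irreducible chains on a finite set\<close>

lemma ex_pmf_of_weights:
  fixes f :: "'a::finite \<Rightarrow> real"
  assumes "\<And>x. 0 \<le> f x" and "(\<Sum>x\<in>UNIV. f x) = 1"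
  shows "\<exists>p. \<forall>x. pmf p x = f x"
proof -
  have "(\<integral>\<^sup>+x. ennreal (f x) \<partial>count_space UNIV) = 1"
    using assms by (simp add: nn_integral_count_space_finite sum_ennreal)
  thus ?thesis using assms pmf_embed_pmf[of f] by blast
qed

text \<open>Irreducibility is recorded as the absence of proper closed sets: this form depends only on
  the support of \<open>P\<close>, so it passes to the twisted matrices at once, and it turns every propagation
  argument below into the choice of a set.\<close>

locale irreducible_chain =
  fixes P :: "real ^ 'a ^ 'a::finite"
  assumes nonneg: "0 \<le> P $ x $ y"
    and row_sum: "(\<Sum>y\<in>UNIV. P $ x $ y) = 1"
    and closed_set_UNIV:
      "S \<noteq> {} \<Longrightarrow> (\<And>x y. x \<in> S \<Longrightarrow> P $ x $ y > 0 \<Longrightarrow> y \<in> S) \<Longrightarrow> S = UNIV"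
begin

lemma mult_vec: "P *v vec c = vec c"
  using row_sum by (simp add: vec_eq_iff matrix_vector_mult_def flip: sum_distrib_right)

text \<open>The maximum principle: where \<open>g\<close> is maximal, the average of \<open>g\<close> cannot exceed \<open>g\<close>, and it
  reaches \<open>g\<close> only if every successor is again a maximal point.\<close>

lemma maximum_principle:
  assumes s: "0 \<le> s" and sub: "\<And>x. g $ x + s \<le> (P *v g) $ x"
  shows "s = 0 \<and> g = vec (g $ z)"
proof -
  define M where "M = Max (range (($) g))"
  define S where "S = {x. g $ x = M}"
  have le: "g $ y \<le> M" for y unfolding M_def by (rule Max_ge) auto
  have "M \<in> range (($) g)" unfolding M_def by (rule Max_in) auto
  hence ne: "S \<noteq> {}" by (auto simp: S_def)
  have max_pt: "s = 0 \<and> (\<forall>y. P $ x $ y > 0 \<longrightarrow> y \<in> S)" if "x \<in> S" for x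
  proof -
    have "(\<Sum>y\<in>UNIV. P $ x $ y * (M - g $ y)) = M - (P *v g) $ x"
      by (simp add: right_diff_distrib sum_subtractf row_sum matrix_vector_mult_def
          flip: sum_distrib_right)
    also have "\<dots> \<le> - s" using sub[of x] that by (simp add: S_def)
    finally have le_s: "(\<Sum>y\<in>UNIV. P $ x $ y * (M - g $ y)) \<le> - s" .
    have terms: "0 \<le> P $ x $ y * (M - g $ y)" for y using nonneg le[of y] by simp
    hence ge: "0 \<le> (\<Sum>y\<in>UNIV. P $ x $ y * (M - g $ y))" by (intro sum_nonneg) auto
    have "(\<Sum>y\<in>UNIV. P $ x $ y * (M - g $ y)) = 0" using s le_s ge by linarith
    hence "P $ x $ y * (M - g $ y) = 0" for y
      using terms by (subst (asm) sum_nonneg_eq_0_iff) auto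
    hence "P $ x $ y > 0 \<Longrightarrow> g $ y = M" for y by (metis less_irrefl mult_eq_0_iff right_minus_eq)
    moreover have "s = 0" using s le_s ge by linarith
    ultimately show ?thesis by (simp add: S_def)
  qed
  have "S = UNIV" using max_pt by (intro closed_set_UNIV[OF ne]) auto
  hence "g $ y = M" for y by (auto simp: S_def)
  hence "g = vec (g $ z)" by (simp add: vec_eq_iff)
  with max_pt ne show ?thesis by auto
qed

text \<open>If \<open>g\<close> is nonnegative and superharmonic up to an error \<open>C\<close>, then \<open>P(x,y) g(y) \<le> g(x) + C\<close>, so
  the value at \<open>x\<close> bounds the values at its successors; by irreducibility it bounds all values,
  with a factor that depends on \<open>P\<close> alone.\<close>

lemma Harnack_bound:
  "\<exists>b\<ge>0. \<forall>g C x y. (\<forall>z. 0 \<le> g $ z) \<longrightarrow> 0 \<le> C \<longrightarrow> (\<forall>z. (P *v g) $ z \<le> g $ z + C) \<longrightarrow>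
     g $ y \<le> b * (g $ x + C)"
proof -
  define adm where "adm g C \<longleftrightarrow> (\<forall>z. 0 \<le> g $ z) \<and> 0 \<le> C \<and> (\<forall>z. (P *v g) $ z \<le> g $ z + C)"
    for g :: "real ^ 'a" and C
  define S where "S x = {y. \<exists>b\<ge>0. \<forall>g C. adm g C \<longrightarrow> g $ y \<le> b * (g $ x + C)}" for x
  have "S x = UNIV" for x
  proof (rule closed_set_UNIV)
    have "x \<in> S x" unfolding S_def by (auto simp: adm_def intro!: exI[of _ 1])
    thus "S x \<noteq> {}" by auto
  next
    fix y z assume "y \<in> S x" and p: "P $ y $ z > 0"
    then obtain b where b: "0 \<le> b" "\<And>g C. adm g C \<Longrightarrow> g $ y \<le> b * (g $ x + C)"
      by (auto simp: S_def)
    have "g $ z \<le> ((b + 1) / P $ y $ z) * (g $ x + C)" if adm: "adm g C" for g C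
    proof -
      have "P $ y $ z * g $ z \<le> (P *v g) $ y"
        unfolding matrix_vector_mult_def vec_lambda_beta
        using adm nonneg by (intro member_le_sum) (auto simp: adm_def)
      also have "\<dots> \<le> g $ y + C" using adm by (auto simp: adm_def)
      also have "\<dots> \<le> b * (g $ x + C) + (g $ x + C)"
        using b(2)[OF adm] adm by (force simp: adm_def intro!: add_mono)
      finally show ?thesis using p by (simp add: field_simps)
    qed
    thus "z \<in> S x" using b(1) p unfolding S_def
      by (intro CollectI exI[of _ "(b + 1) / P $ y $ z"]) auto
  qed
  hence "\<exists>b. 0 \<le> b \<and> (\<forall>g C. adm g C \<longrightarrow> g $ y \<le> b * (g $ x + C))" for x y
    by (auto simp: S_def set_eq_iff)
  hence "\<exists>b. \<forall>x y. 0 \<le> b x y \<and> (\<forall>g C. adm g C \<longrightarrow> g $ y \<le> b x y * (g $ x + C))"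
    by (intro choice allI)
  then obtain b where b: "\<And>x y. 0 \<le> b x y"
    "\<And>x y g C. adm g C \<Longrightarrow> g $ y \<le> b x y * (g $ x + C)" by blast
  define B where "B = (\<Sum>x\<in>UNIV. \<Sum>y\<in>UNIV. b x y)"
  have "b x y \<le> B" for x y
  proof -
    have "b x y \<le> (\<Sum>y\<in>UNIV. b x y)" using b by (intro member_le_sum) auto
    also have "\<dots> \<le> B" unfolding B_def
      using b by (intro member_le_sum[of x UNIV "\<lambda>x. \<Sum>y\<in>UNIV. b x y"]) (auto intro!: sum_nonneg)
    finally show ?thesis .
  qed
  hence "g $ y \<le> B * (g $ x + C)" if "adm g C" for g C x y
    using b(2)[OF that, of y x] that
    by (meson adm_def add_nonneg_nonneg mult_right_mono order_trans)
  moreover have "0 \<le> B" unfolding B_def using b by (intro sum_nonneg) auto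
  ultimately show ?thesis unfolding adm_def by blast
qed

text \<open>Pinning one coordinate makes \<open>I - P\<close> invertible: its kernel consists of the constants, and
  its range meets the constants only in \<open>0\<close>.\<close>

definition pinned :: "'a \<Rightarrow> real ^ 'a ^ 'a" where
  "pinned z = mat 1 - P + (\<chi> x y. if y = z then 1 else 0)"

lemma pinned_mult: "pinned z *v k = k - P *v k + vec (k $ z)"
  by (simp add: pinned_def matrix_vector_mult_add_rdistrib matrix_vector_mult_diff_rdistrib
      vec_eq_iff) (simp add: matrix_vector_mult_def mult_delta_left)

lemma pinned_kernel:
  assumes "pinned z *v k = 0"
  shows "k = 0"
proof -
  have Pk: "(P *v k) $ x = k $ x + k $ z" for x
    using assms by (simp add: pinned_mult vec_eq_iff algebra_simps)
  have "k $ z = 0 \<and> k = vec (k $ z)"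
  proof (cases "0 \<le> k $ z")
    case True
    thus ?thesis using Pk by (intro maximum_principle) auto
  next
    case False
    moreover have "P *v (- k) = - (P *v k)" using matrix_vector_mult_diff_distrib[of P 0 k] by simp
    ultimately have "- k $ z = 0 \<and> - k = vec ((- k) $ z)"
      using Pk by (intro maximum_principle) auto
    thus ?thesis by (auto simp: vec_eq_iff)
  qed
  thus ?thesis by (auto simp: vec_eq_iff)
qed

lemma pinned_inverse: obtains N where "N ** pinned z = mat 1" "pinned z ** N = mat 1"
  using pinned_kernel matrix_left_invertible_ker matrix_left_right_inverse by metis

text \<open>For row vectors of total mass \<open>1\<close>, invariance is a linear system whose matrix is invertible;
  this gives existence and uniqueness of the invariant pmf at the same time.\<close>

lemma invariant_row_iff:
  assumes "(\<Sum>x\<in>UNIV. p $ x) = 1"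
  shows "p v* P = p \<longleftrightarrow> p v* pinned z = axis z 1"
proof -
  have "p v* (\<chi> x y. if y = z then 1 else 0) = axis z 1"
    using assms by (auto simp: vector_matrix_mult_def axis_def vec_eq_iff mult_delta_right)
  thus ?thesis
    by (auto simp: pinned_def vector_matrix_mult_add_rdistrib vector_matrix_mult_diff_rdistrib)
qed

lemma pinned_row_cancel:
  assumes "p v* pinned z = q v* pinned z"
  shows "p = q"
  by (metis assms pinned_inverse[of z] vector_matrix_mul_assoc vector_matrix_mul_rid)

lemma mult_row_total: "(\<Sum>y\<in>UNIV. (p v* P) $ y) = (\<Sum>x\<in>UNIV. p $ x)"
proof -
  have "(\<Sum>y\<in>UNIV. (p v* P) $ y) = (\<Sum>x\<in>UNIV. \<Sum>y\<in>UNIV. p $ x * P $ x $ y)"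
    unfolding vector_matrix_mult_def vec_lambda_beta by (rule sum.swap)
  thus ?thesis by (simp add: row_sum flip: sum_distrib_left)
qed

text \<open>The solution of the system is nonnegative because the vector of its absolute values, once
  normalized, solves the same system.\<close>

lemma ex1_invariant: "\<exists>!\<pi>. invariant_for P \<pi>"
proof -
  obtain z :: 'a where True by simp
  obtain N where N: "N ** pinned z = mat 1" by (rule pinned_inverse)
  define p where "p = axis z 1 v* N"
  have p: "p v* pinned z = axis z 1" by (simp add: p_def vector_matrix_mul_assoc N)
  have "(\<Sum>x\<in>UNIV. p $ x) = inner p (pinned z *v vec 1)"
    using mult_vec[of 1] by (simp add: pinned_mult inner_vec_def)
  also have "\<dots> = 1" by (simp add: p inner_axis' flip: dot_lmul_matrix)
  finally have total: "(\<Sum>x\<in>UNIV. p $ x) = 1" .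
  have inv: "p v* P = p" using invariant_row_iff[OF total] p by blast
  define a where "a = (\<chi> x. \<bar>p $ x\<bar>)"
  have a_le: "a $ y \<le> (a v* P) $ y" for y
  proof -
    have "a $ y = \<bar>\<Sum>x\<in>UNIV. p $ x * P $ x $ y\<bar>"
      using inv by (simp add: a_def vector_matrix_mult_def vec_eq_iff)
    also have "\<dots> \<le> (\<Sum>x\<in>UNIV. \<bar>p $ x * P $ x $ y\<bar>)" by (rule sum_abs)
    also have "\<dots> = (a v* P) $ y" using nonneg by (simp add: vector_matrix_mult_def abs_mult a_def)
    finally show ?thesis .
  qed
  \<comment> \<open>Equality holds in each coordinate, as both sides have the same total mass.\<close>
  have "(\<Sum>y\<in>UNIV. (a v* P) $ y - a $ y) = 0" by (simp add: sum_subtractf mult_row_total)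
  hence "\<forall>y\<in>UNIV. (a v* P) $ y - a $ y = 0"
    using a_le by (subst (asm) sum_nonneg_eq_0_iff) auto
  hence a_inv: "a v* P = a" by (simp add: vec_eq_iff)
  define m where "m = (\<Sum>x\<in>UNIV. a $ x)"
  have "1 \<le> m" using total sum_mono[of UNIV "($) p" "($) a"] by (simp add: m_def a_def)
  define q where "q = (1 / m) *\<^sub>R a"
  have q_total: "(\<Sum>x\<in>UNIV. q $ x) = 1"
    using \<open>1 \<le> m\<close> by (simp add: q_def m_def flip: sum_divide_distrib)
  have "q v* P = q" by (simp add: q_def a_inv scaleR_vector_matrix_assoc)
  hence "q = p" using invariant_row_iff[OF q_total] p pinned_row_cancel by metis
  moreover have "0 \<le> q $ x" for x using \<open>1 \<le> m\<close> by (simp add: q_def a_def)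
  ultimately have p_nonneg: "0 \<le> p $ x" for x by simp
  obtain \<pi> where \<pi>: "pmf_vec \<pi> = p"
    using ex_pmf_of_weights[of "($) p"] p_nonneg total by (auto simp: pmf_vec_def vec_eq_iff)
  show ?thesis
  proof (rule ex1I[of _ \<pi>])
    show "invariant_for P \<pi>" by (simp add: invariant_for_def \<pi> inv)
  next
    fix \<rho> assume "invariant_for P \<rho>"
    moreover have "(\<Sum>x\<in>UNIV. pmf_vec \<rho> $ x) = 1" by (simp add: pmf_vec_def sum_pmf_eq_1)
    ultimately have "pmf_vec \<rho> = p"
      using invariant_row_iff p pinned_row_cancel unfolding invariant_for_def by metis
    thus "\<rho> = \<pi>" using \<pi> by (auto simp: pmf_vec_def vec_eq_iff intro!: pmf_eqI)
  qed
qed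

lemma invariant_pmf: "invariant_for P (invariant_pmf P)"
  unfolding invariant_pmf_def using ex1_invariant by (rule theI')

text \<open>The fundamental matrix solves the Poisson equation \<open>H - P H = U - \<pi>(U)\<close>, and passing to
  \<open>H\<^sup>\<circ>\<close> normalizes the solution at \<open>z\<close>.\<close>

lemma H_circ_Poisson:
  "H_circ U z P - P *v H_circ U z P = U - vec (\<Sum>x\<in>UNIV. pmf (invariant_pmf P) x * U $ x)"
proof -
  define \<pi> where "\<pi> = invariant_pmf P"
  define A where "A = mat 1 - P + (\<chi> x y. pmf \<pi> y)"
  define G where "G = fundamental_matrix P *v U"
  have A_mult: "A *v g = g - P *v g + vec (inner (pmf_vec \<pi>) g)" for g
    by (simp add: A_def matrix_vector_mult_add_rdistrib matrix_vector_mult_diff_rdistrib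
        vec_eq_iff) (simp add: matrix_vector_mult_def inner_vec_def pmf_vec_def)
  have \<pi>_A: "inner (pmf_vec \<pi>) (A *v g) = inner (pmf_vec \<pi>) g" for g
  proof -
    have "inner (pmf_vec \<pi>) (P *v g) = inner (pmf_vec \<pi>) g"
      using invariant_pmf by (simp add: \<pi>_def invariant_for_def flip: dot_lmul_matrix)
    moreover have "inner (pmf_vec \<pi>) (vec c) = c" for c
      by (simp add: inner_vec_def pmf_vec_def sum_pmf_eq_1 flip: sum_distrib_right)
    ultimately show ?thesis by (simp add: A_mult inner_right_distrib inner_diff_right)
  qed
  have "g = 0" if "A *v g = 0" for g
  proof -
    have "inner (pmf_vec \<pi>) g = 0" using \<pi>_A[of g] that by simp
    hence "P *v g = g" using that by (simp add: A_mult vec_eq_iff)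
    \<comment> \<open>Subtracting a constant from \<open>g\<close> leads back to the kernel of \<open>pinned z\<close>.\<close>
    hence "pinned z *v (g - vec (g $ z)) = 0"
      by (simp add: pinned_mult matrix_vector_mult_diff_distrib mult_vec vec_eq_iff)
    hence "g = vec (g $ z)" using pinned_kernel by fastforce
    moreover have "inner (pmf_vec \<pi>) (vec (g $ z)) = g $ z"
      by (simp add: inner_vec_def pmf_vec_def sum_pmf_eq_1 flip: sum_distrib_right)
    ultimately show "g = 0" using \<open>inner (pmf_vec \<pi>) g = 0\<close> by (metis vec_0)
  qed
  hence "invertible A" by (metis invertible_left_inverse matrix_left_invertible_ker)
  hence "A ** fundamental_matrix P = mat 1"
    unfolding fundamental_matrix_def matrix_inv_def invertible_def A_def \<pi>_def
    by (rule someI2_ex) auto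
  hence AG: "A *v G = U" by (simp add: G_def matrix_vector_mul_assoc)
  have mean: "inner (pmf_vec \<pi>) G = (\<Sum>x\<in>UNIV. pmf \<pi> x * U $ x)"
    using \<pi>_A[of G] by (simp add: AG inner_vec_def pmf_vec_def)
  have H: "H_circ U z P = G - vec (G $ z)"
    by (simp add: H_circ_def G_def matrix_vector_mult_def vec_eq_iff left_diff_distrib
        sum_subtractf)
  show ?thesis
    using AG unfolding A_mult H mean \<pi>_def[symmetric]
    by (simp add: matrix_vector_mult_diff_distrib mult_vec algebra_simps)
qed

lemma H_circ_base: "H_circ U z P $ z = 0"
  by (simp add: H_circ_def)

text \<open>The support of \<open>\<pi>\<close> is closed under \<open>M\<close>, hence under \<open>P\<close>, whose rows agree with those of \<open>M\<close>
  there.\<close>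

lemma invariant_full_support:
  assumes inv: "invariant_for M \<pi>" and M: "\<And>x y. 0 \<le> M $ x $ y"
    and eq: "\<And>x. pmf \<pi> x > 0 \<Longrightarrow> M $ x = P $ x"
  shows "pmf \<pi> x > 0"
proof -
  have "{x. pmf \<pi> x > 0} = UNIV"
  proof (rule closed_set_UNIV)
    show "{x. pmf \<pi> x > 0} \<noteq> {}" using set_pmf_not_empty[of \<pi>] by (auto simp: set_pmf_eq')
  next
    fix x y assume x: "x \<in> {x. pmf \<pi> x > 0}" and "P $ x $ y > 0"
    hence "0 < pmf \<pi> x * M $ x $ y" using eq by simp
    also have "\<dots> \<le> (pmf_vec \<pi> v* M) $ y"
      unfolding vector_matrix_mult_def vec_lambda_beta pmf_vec_def
      using M by (intro member_le_sum[of x UNIV "\<lambda>x. pmf \<pi> x * M $ x $ y"]) auto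
    also have "\<dots> = pmf \<pi> y" using inv by (simp add: invariant_for_def pmf_vec_def)
    finally show "y \<in> {x. pmf \<pi> x > 0}" by simp
  qed
  thus ?thesis by auto
qed

end
section \<open>Relative entropy\<close>

definition row_divergence :: "real ^ 'a::finite \<Rightarrow> real ^ 'a \<Rightarrow> real" where
  "row_divergence p q = (\<Sum>y\<in>UNIV. p $ y * ln (p $ y / q $ y))"

text \<open>Summing \<open>p ln (p / q) \<ge> p - q\<close> over the coordinates gives nonnegativity, and equality in
  each summand forces \<open>p = q\<close>.\<close>

lemma Gibbs_inequality:
  assumes p: "\<And>y. 0 \<le> p $ y" "(\<Sum>y\<in>UNIV. p $ y) = 1"
    and q: "\<And>y. 0 \<le> q $ y" "(\<Sum>y\<in>UNIV. q $ y) = 1"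
    and ac: "\<And>y. p $ y > 0 \<Longrightarrow> q $ y > 0"
  shows "0 \<le> row_divergence p q" and "row_divergence p q = 0 \<longleftrightarrow> p = q"
proof -
  define t where "t y = p $ y * ln (p $ y / q $ y) - (p $ y - q $ y)" for y
  have t: "0 \<le> t y \<and> (t y = 0 \<longrightarrow> p $ y = q $ y)" for y
  proof (cases "p $ y = 0")
    case True
    thus ?thesis using q by (simp add: t_def)
  next
    case False
    hence pos: "0 < p $ y" "0 < q $ y" using p(1)[of y] ac[of y] by auto
    define r where "r = q $ y / p $ y"
    have r: "0 < r" using pos by (simp add: r_def)
    have "t y = p $ y * (r - 1 - ln r)"
      using pos by (simp add: t_def r_def ln_div algebra_simps)
    thus ?thesis
      using pos ln_le_minus_one[OF r] ln_eq_minus_one[OF r] by (auto simp: r_def)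
  qed
  have D: "row_divergence p q = (\<Sum>y\<in>UNIV. t y)"
    by (simp add: t_def row_divergence_def sum_subtractf p q)
  show "0 \<le> row_divergence p q" unfolding D using t by (intro sum_nonneg) auto
  show "row_divergence p q = 0 \<longleftrightarrow> p = q"
  proof
    assume "row_divergence p q = 0"
    hence "\<forall>y\<in>UNIV. t y = 0" unfolding D using t by (subst (asm) sum_nonneg_eq_0_iff) auto
    thus "p = q" using t by (simp add: vec_eq_iff)
  next
    assume "p = q"
    thus "row_divergence p q = 0"
      by (auto simp: row_divergence_def intro!: sum.neutral)
  qed
qed

lemma rel_entropy_term_real:
  assumes "0 \<le> p" "p > 0 \<Longrightarrow> q > 0"
  shows "rel_entropy_term p q = ereal (p * ln (p / q))"
  using assms by (cases "p = 0") (auto simp: rel_entropy_term_def zero_ereal_def)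

lemma rel_entropy_term_infinite: "0 < p \<Longrightarrow> q = 0 \<Longrightarrow> rel_entropy_term p q = \<infinity>"
  by (simp add: rel_entropy_term_def)


section \<open>Admissible and twisted transition matrices\<close>

lemma transition_matrix_nonneg: "0 \<le> transition_matrix Q R $ x $ y"
  by (simp add: transition_matrix_def)

lemma sum_transition_fst:
  "(\<Sum>y\<in>UNIV. transition_matrix Q R $ x $ y * f (fst y)) = (\<Sum>u\<in>UNIV. pmf (R x) u * f u)"
proof -
  have "(\<Sum>y\<in>UNIV. transition_matrix Q R $ x $ y * f (fst y)) =
      (\<Sum>u\<in>UNIV. \<Sum>n\<in>UNIV. pmf (R x) u * f u * pmf (Q x) n)"
    unfolding transition_matrix_def
    by (simp add: sum.cartesian_product case_prod_unfold mult_ac)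
  thus ?thesis by (simp add: sum_pmf_eq_1 flip: sum_distrib_left)
qed

lemma transition_matrix_row_sum: "(\<Sum>y\<in>UNIV. transition_matrix Q R $ x $ y) = 1"
  using sum_transition_fst[of Q R x "\<lambda>_. 1"] by (simp add: sum_pmf_eq_1)

lemma transition_matrix_mult:
  "(transition_matrix Q R *v h) $ x =
     (\<Sum>y\<in>UNIV. transition_matrix Q R $ x $ y * cond_fun Q h x (fst y))"
proof -
  have "(transition_matrix Q R *v h) $ x =
      (\<Sum>u\<in>UNIV. \<Sum>n\<in>UNIV. pmf (R x) u * pmf (Q x) n * h $ (u, n))"
    unfolding transition_matrix_def matrix_vector_mult_def
    by (simp add: sum.cartesian_product case_prod_unfold)
  also have "\<dots> = (\<Sum>u\<in>UNIV. pmf (R x) u * cond_fun Q h x u)"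
    by (simp add: cond_fun_def sum_distrib_left mult_ac)
  finally show ?thesis by (simp add: sum_transition_fst)
qed

text \<open>A set that is closed under the positive entries of \<open>P\<close> is closed under those of its powers.\<close>

lemma irreducible_matrix_closed_set:
  assumes irr: "irreducible_matrix P" and nn: "\<And>x y. 0 \<le> P $ x $ y"
    and ne: "S \<noteq> {}" and closed: "\<And>x y. x \<in> S \<Longrightarrow> P $ x $ y > 0 \<Longrightarrow> y \<in> S"
  shows "S = UNIV"
proof -
  have pow: "y \<in> S" if "x \<in> S" "matrix_power P k $ x $ y > 0" for k x y
    using that
  proof (induction k arbitrary: x)
    case 0
    thus ?case by (auto simp: mat_def split: if_splits)
  next
    case (Suc k)
    have "\<exists>z. P $ x $ z * matrix_power P k $ z $ y > 0"
    proof (rule ccontr)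
      assume "\<not> ?thesis"
      hence "(\<Sum>z\<in>UNIV. P $ x $ z * matrix_power P k $ z $ y) \<le> 0"
        by (intro sum_nonpos) (auto simp: not_less)
      thus False using Suc.prems by (simp add: matrix_matrix_mult_def)
    qed
    then obtain z where "P $ x $ z * matrix_power P k $ z $ y > 0" ..
    hence "P $ x $ z > 0" "matrix_power P k $ z $ y > 0"
      using nn[of x z] by (auto simp: zero_less_mult_iff)
    thus ?case using Suc closed by blast
  qed
  obtain x where "x \<in> S" using ne by auto
  thus ?thesis using irr pow unfolding irreducible_matrix_def by blast
qed

locale controlled_chain =
  fixes Q\<^sub>0 :: "('u::finite \<times> 'n::finite) \<Rightarrow> 'n pmf"
    and R\<^sub>0 :: "'u \<times> 'n \<Rightarrow> 'u pmf"
    and U :: "real ^ ('u \<times> 'n)"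
    and x\<^sub>0 :: "'u \<times> 'n"
  assumes irreducible: "irreducible_matrix (transition_matrix Q\<^sub>0 R\<^sub>0)"
begin

(* States are pairs, but they are handled as atoms throughout. *)
declare split_paired_All [simp del] split_paired_Ex [simp del]

abbreviation nominal ("P\<^sub>0") where "P\<^sub>0 \<equiv> transition_matrix Q\<^sub>0 R\<^sub>0"
abbreviation twisted ("T") where "T \<equiv> twisted_matrix Q\<^sub>0 R\<^sub>0"
abbreviation normalizer ("\<Lambda>") where "\<Lambda> \<equiv> log_normalizer Q\<^sub>0 R\<^sub>0"

lemma exp_normalizer:
  "exp (\<Lambda> h x) = (\<Sum>y\<in>UNIV. P\<^sub>0 $ x $ y * exp (cond_fun Q\<^sub>0 h x (fst y)))"
proof -
  have "\<exists>y. P\<^sub>0 $ x $ y > 0"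
  proof (rule ccontr)
    assume "\<not> ?thesis"
    hence "(\<Sum>y\<in>UNIV. P\<^sub>0 $ x $ y) \<le> 0" by (intro sum_nonpos) (auto simp: not_less)
    thus False by (simp add: transition_matrix_row_sum)
  qed
  then obtain y where y: "P\<^sub>0 $ x $ y > 0" ..
  have "(\<Sum>y\<in>UNIV. P\<^sub>0 $ x $ y * exp (cond_fun Q\<^sub>0 h x (fst y))) > 0"
    using y by (intro sum_pos2[of UNIV y]) (simp_all add: transition_matrix_nonneg)
  thus ?thesis by (simp add: log_normalizer_def)
qed

lemma twisted_row_sum: "(\<Sum>y\<in>UNIV. T h $ x $ y) = 1"
proof -
  have "(\<Sum>y\<in>UNIV. T h $ x $ y) =
      (\<Sum>y\<in>UNIV. P\<^sub>0 $ x $ y * exp (cond_fun Q\<^sub>0 h x (fst y))) / exp (\<Lambda> h x)"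
    by (simp add: twisted_matrix_def exp_diff sum_divide_distrib)
  thus ?thesis by (simp flip: exp_normalizer)
qed

lemma twisted_pos_iff: "T h $ x $ y > 0 \<longleftrightarrow> P\<^sub>0 $ x $ y > 0"
  by (simp add: twisted_matrix_def zero_less_mult_iff)

lemma twisted_nonneg: "0 \<le> T h $ x $ y"
  by (simp add: twisted_matrix_def transition_matrix_nonneg)

lemma twisted_irreducible: "irreducible_chain (T h)"
proof
  fix S :: "('u \<times> 'n) set" assume "S \<noteq> {}" "\<And>x y. x \<in> S \<Longrightarrow> T h $ x $ y > 0 \<Longrightarrow> y \<in> S"
  thus "S = UNIV"
    using irreducible_matrix_closed_set[OF irreducible transition_matrix_nonneg]
    by (simp add: twisted_pos_iff)
qed (rule twisted_nonneg twisted_row_sum)+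

text \<open>The twist only involves \<open>x'\<^sub>u\<close>, so it is absorbed by the decision rule.\<close>

lemma twisted_admissible: obtains R where "T h = transition_matrix Q\<^sub>0 R"
proof -
  define w where "w x u = pmf (R\<^sub>0 x) u * exp (cond_fun Q\<^sub>0 h x u - \<Lambda> h x)" for x u
  have "(\<Sum>u\<in>UNIV. w x u) = (\<Sum>y\<in>UNIV. T h $ x $ y)" for x
    using sum_transition_fst[of Q\<^sub>0 R\<^sub>0 x "\<lambda>u. exp (cond_fun Q\<^sub>0 h x u - \<Lambda> h x)"]
    by (simp add: w_def twisted_matrix_def)
  hence "\<exists>p. \<forall>u. pmf p u = w x u" for x
    by (intro ex_pmf_of_weights) (auto simp: w_def twisted_row_sum)
  then obtain R where R: "\<And>x u. pmf (R x) u = w x u" by metis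
  have "T h = transition_matrix Q\<^sub>0 R"
    by (simp add: vec_eq_iff twisted_matrix_def transition_matrix_def R w_def)
  thus ?thesis by (rule that)
qed

lemma cond_fun_zero: "cond_fun Q\<^sub>0 0 x u = 0"
  by (simp add: cond_fun_def)

lemma normalizer_zero: "\<Lambda> 0 x = 0"
  by (simp add: log_normalizer_def cond_fun_zero transition_matrix_row_sum)

lemma twisted_zero: "T 0 = P\<^sub>0"
  by (simp add: twisted_matrix_def cond_fun_zero normalizer_zero vec_eq_iff)

lemma cond_fun_shift: "cond_fun Q\<^sub>0 (h + vec c) x u = cond_fun Q\<^sub>0 h x u + c"
  by (simp add: cond_fun_def distrib_left sum.distrib sum_pmf_eq_1 flip: sum_distrib_right)

lemma normalizer_shift: "\<Lambda> (h + vec c) x = \<Lambda> h x + c"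
proof -
  have "exp (\<Lambda> (h + vec c) x) = exp (\<Lambda> h x + c)"
    unfolding exp_add exp_normalizer
    by (simp add: cond_fun_shift exp_add sum_distrib_right mult.assoc)
  thus ?thesis by simp
qed

lemma twisted_shift: "T (h + vec c) = T h"
  by (simp add: twisted_matrix_def cond_fun_shift normalizer_shift)

text \<open>The Gibbs variational formula: up to terms that do not depend on the decision rule, the
  quantity to be maximized in the optimality equation is minus the divergence from the twisted
  row.\<close>

lemma divergence_from_twisted:
  fixes R defines "P \<equiv> transition_matrix Q\<^sub>0 R"
  assumes ac: "\<And>y. P $ x $ y > 0 \<Longrightarrow> P\<^sub>0 $ x $ y > 0"
  shows "row_divergence (P $ x) (T h $ x) = row_divergence (P $ x) (P\<^sub>0 $ x) - (P *v h) $ x + \<Lambda> h x"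
proof -
  have "row_divergence (P $ x) (T h $ x) =
      (\<Sum>y\<in>UNIV. P $ x $ y * ln (P $ x $ y / P\<^sub>0 $ x $ y)
         - P $ x $ y * cond_fun Q\<^sub>0 h x (fst y) + P $ x $ y * \<Lambda> h x)"
    unfolding row_divergence_def
  proof (rule sum.cong[OF refl])
    fix y
    show "P $ x $ y * ln (P $ x $ y / T h $ x $ y) = P $ x $ y * ln (P $ x $ y / P\<^sub>0 $ x $ y)
         - P $ x $ y * cond_fun Q\<^sub>0 h x (fst y) + P $ x $ y * \<Lambda> h x"
    proof (cases "P $ x $ y = 0")
      case False
      hence pos: "0 < P $ x $ y" "0 < P\<^sub>0 $ x $ y"
        using ac[of y] transition_matrix_nonneg[of Q\<^sub>0 R x y] by (auto simp: P_def)
      hence "ln (P $ x $ y / T h $ x $ y) =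
          ln (P $ x $ y / P\<^sub>0 $ x $ y) - (cond_fun Q\<^sub>0 h x (fst y) - \<Lambda> h x)"
        by (simp add: twisted_matrix_def ln_div ln_mult)
      thus ?thesis by (simp only:) (simp only: algebra_simps)
    qed simp
  qed
  also have "\<dots> = row_divergence (P $ x) (P\<^sub>0 $ x) - (P *v h) $ x + \<Lambda> h x"
    unfolding P_def transition_matrix_mult row_divergence_def
    by (simp add: sum.distrib sum_subtractf transition_matrix_row_sum flip: sum_distrib_right)
  finally show ?thesis .
qed

lemma divergence_from_twisted_nonneg:
  fixes R defines "P \<equiv> transition_matrix Q\<^sub>0 R"
  assumes ac: "\<And>y. P $ x $ y > 0 \<Longrightarrow> P\<^sub>0 $ x $ y > 0"
  shows "0 \<le> row_divergence (P $ x) (T h $ x)"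
    and "row_divergence (P $ x) (T h $ x) = 0 \<longleftrightarrow> P $ x = T h $ x"
  using Gibbs_inequality[of "P $ x" "T h $ x"] ac
  by (simp_all add: P_def transition_matrix_nonneg transition_matrix_row_sum twisted_nonneg
      twisted_row_sum twisted_pos_iff)

text \<open>\<open>\<Lambda>\<close> is convex with gradient \<open>T h\<close>: this is the tangent inequality at \<open>h\<close>, obtained by using the
  row of \<open>T h\<close>, which is optimal for \<open>h\<close>, as a test row for \<open>g\<close>.\<close>

lemma normalizer_tangent: "\<Lambda> h x + (T h *v (g - h)) $ x \<le> \<Lambda> g x"
proof -
  obtain R where R: "T h = transition_matrix Q\<^sub>0 R" by (rule twisted_admissible)
  have ac: "transition_matrix Q\<^sub>0 R $ x $ y > 0 \<Longrightarrow> P\<^sub>0 $ x $ y > 0" for y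
    by (simp add: twisted_pos_iff flip: R)
  show ?thesis
    using divergence_from_twisted[of R x g, OF ac] divergence_from_twisted[of R x h, OF ac]
      divergence_from_twisted_nonneg(1)[of R x g, OF ac]
      divergence_from_twisted_nonneg(2)[of R x h, OF ac]
    by (simp add: R matrix_vector_mult_diff_distrib)
qed

lemma normalizer_Jensen: "(P\<^sub>0 *v g) $ x \<le> \<Lambda> g x"
  using normalizer_tangent[of 0 x g] by (simp add: normalizer_zero twisted_zero)

lemma cond_fun_has_derivative:
  "((\<lambda>h. cond_fun Q\<^sub>0 h x u) has_derivative (\<lambda>k. cond_fun Q\<^sub>0 k x u)) (at h)"
  unfolding cond_fun_def
  by (intro has_derivative_sum has_derivative_mult_right
      bounded_linear.has_derivative[OF bounded_linear_vec_nth] has_derivative_ident)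

lemma normalizer_has_derivative:
  "((\<lambda>h. \<Lambda> h x) has_derivative (\<lambda>k. (T h *v k) $ x)) (at h)"
proof -
  define e where "e h y = exp (cond_fun Q\<^sub>0 h x (fst y))" for h and y :: "'u \<times> 'n"
  have e: "((\<lambda>h. e h y) has_derivative (\<lambda>k. cond_fun Q\<^sub>0 k x (fst y) * e h y)) (at h)" for y
    unfolding e_def by (auto intro!: derivative_eq_intros cond_fun_has_derivative simp: mult_ac)
  have Z: "(\<Sum>y\<in>UNIV. P\<^sub>0 $ x $ y * e h y) = exp (\<Lambda> h x)"
    by (simp add: e_def exp_normalizer)
  hence Z_pos: "(\<Sum>y\<in>UNIV. P\<^sub>0 $ x $ y * e h y) > 0" by simp
  have "((\<lambda>h. ln (\<Sum>y\<in>UNIV. P\<^sub>0 $ x $ y * e h y)) has_derivative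
      (\<lambda>k. (\<Sum>y\<in>UNIV. P\<^sub>0 $ x $ y * (cond_fun Q\<^sub>0 k x (fst y) * e h y)) *
            inverse (\<Sum>y\<in>UNIV. P\<^sub>0 $ x $ y * e h y))) (at h)"
    by (rule has_derivative_eq_rhs[OF has_derivative_ln[OF Z_pos
          has_derivative_sum[OF has_derivative_mult_right[OF e]]]]) (simp add: mult.commute)
  moreover have "(\<Sum>y\<in>UNIV. P\<^sub>0 $ x $ y * (cond_fun Q\<^sub>0 k x (fst y) * e h y)) *
      inverse (exp (\<Lambda> h x)) = (T h *v k) $ x" for k
  proof -
    obtain R where R: "T h = transition_matrix Q\<^sub>0 R" by (rule twisted_admissible)
    have "(T h *v k) $ x = (\<Sum>y\<in>UNIV. T h $ x $ y * cond_fun Q\<^sub>0 k x (fst y))"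
      unfolding R by (rule transition_matrix_mult)
    also have "\<dots> = (\<Sum>y\<in>UNIV. P\<^sub>0 $ x $ y * (cond_fun Q\<^sub>0 k x (fst y) * e h y) *
        inverse (exp (\<Lambda> h x)))"
      by (simp add: twisted_matrix_def e_def exp_diff divide_inverse mult_ac)
    finally show ?thesis by (simp only: sum_distrib_right)
  qed
  ultimately show ?thesis
    unfolding log_normalizer_def Z by (simp add: e_def)
qed


section \<open>The optimality equation as a homeomorphism\<close>

text \<open>With \<open>h = v - v(x\<^sub>0)\<close> and \<open>\<eta> = v(x\<^sub>0)\<close>, the equation
  \<open>\<Lambda>\<^sub>h + \<zeta> U = h + \<eta>\<close> reads \<open>aroe_map v = \<zeta> U\<close>: the normalized function and the average reward
  are packed into one unknown vector.\<close>

definition aroe_map :: "real ^ ('u \<times> 'n) \<Rightarrow> real ^ ('u \<times> 'n)" where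
  "aroe_map v = (\<chi> x. v $ x + v $ x\<^sub>0 - \<Lambda> v x)"

lemma aroe_map_shift: "aroe_map (v + vec c) = aroe_map v + vec c"
  by (simp add: aroe_map_def normalizer_shift vec_eq_iff)

lemma aroe_map_zero: "aroe_map 0 = 0"
  by (simp add: aroe_map_def normalizer_zero vec_eq_iff)

lemma aroe_map_has_derivative:
  "(aroe_map has_derivative (\<lambda>k. irreducible_chain.pinned (T h) x\<^sub>0 *v k)) (at h)"
proof -
  have "((\<lambda>v. v $ x + v $ x\<^sub>0 - \<Lambda> v x) has_derivative
      (\<lambda>k. k $ x + k $ x\<^sub>0 - (T h *v k) $ x)) (at h)" for x
    by (intro has_derivative_add has_derivative_diff normalizer_has_derivative
        bounded_linear.has_derivative[OF bounded_linear_vec_nth] has_derivative_ident)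
  moreover have "(irreducible_chain.pinned (T h) x\<^sub>0 *v k) $ x =
      k $ x + k $ x\<^sub>0 - (T h *v k) $ x" for k x
    by (simp add: irreducible_chain.pinned_mult[OF twisted_irreducible])
  ultimately show ?thesis
    unfolding has_derivative_componentwise_within[of aroe_map]
    by (auto simp: Basis_vec_def inner_axis aroe_map_def)
qed

lemma continuous_on_aroe_map: "continuous_on S aroe_map"
  by (intro continuous_at_imp_continuous_on ballI has_derivative_continuous)
    (rule aroe_map_has_derivative)

text \<open>The difference \<open>d\<close> of two solutions is subharmonic for the twisted matrix of one of them, up
  to the constant \<open>d(x\<^sub>0)\<close>, so the maximum principle applies as soon as that constant is
  nonnegative, which can be arranged by exchanging the two.\<close>

lemma inj_aroe_map: "inj aroe_map"
proof (rule injI)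
  fix v w assume eq: "aroe_map v = aroe_map w"
  have *: "v = w" if eq: "aroe_map v = aroe_map w" and le: "v $ x\<^sub>0 \<le> w $ x\<^sub>0" for v w
  proof -
    interpret irreducible_chain "T w" by (rule twisted_irreducible)
    define d where "d = w - v"
    have "d $ x + d $ x\<^sub>0 \<le> (T w *v d) $ x" for x
    proof -
      have "d $ x + d $ x\<^sub>0 = \<Lambda> w x - \<Lambda> v x"
        using arg_cong[OF eq, of "\<lambda>f. f $ x"] by (simp add: aroe_map_def d_def)
      also have "\<dots> \<le> (T w *v d) $ x"
        using normalizer_tangent[of w x v] matrix_vector_mult_diff_distrib[of "T w" 0 d]
        by (simp add: d_def)
      finally show ?thesis .
    qed
    hence "d $ x\<^sub>0 = 0 \<and> d = vec (d $ x\<^sub>0)"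
      using le by (intro maximum_principle) (simp_all add: d_def)
    hence "d = 0" by (metis vec_0)
    thus ?thesis by (simp add: d_def)
  qed
  show "v = w"
    using *[OF eq] *[OF eq[symmetric]] by (cases "v $ x\<^sub>0 \<le> w $ x\<^sub>0") auto
qed

text \<open>The maximum principle bounds \<open>v(x\<^sub>0)\<close>; then Jensen's inequality makes \<open>v\<close> superharmonic for
  the nominal matrix up to a bounded error, and the Harnack bound controls its oscillation.\<close>

lemma aroe_map_proper:
  "\<exists>b. \<forall>v C x. (\<forall>y. \<bar>aroe_map v $ y\<bar> \<le> C) \<longrightarrow> \<bar>v $ x\<bar> \<le> b * C"
proof -
  interpret nominal: irreducible_chain P\<^sub>0 using twisted_irreducible[of 0] by (simp add: twisted_zero)
  obtain b where b: "0 \<le> b" "\<And>g C x y. (\<And>z. 0 \<le> g $ z) \<Longrightarrow> 0 \<le> C \<Longrightarrow>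
      (\<And>z. (P\<^sub>0 *v g) $ z \<le> g $ z + C) \<Longrightarrow> g $ y \<le> b * (g $ x + C)"
    using nominal.Harnack_bound by metis
  have "\<bar>v $ x\<bar> \<le> (2 * b + 1) * C" if bd: "\<And>y. \<bar>aroe_map v $ y\<bar> \<le> C" for v C x
  proof -
    define s where "s = v $ x\<^sub>0"
    have C: "0 \<le> C" using bd[of x] by linarith
    have \<Lambda>: "\<Lambda> v y \<le> v $ y + s + C" "v $ y + s - C \<le> \<Lambda> v y" for y
      using bd[of y] by (auto simp: aroe_map_def s_def abs_le_iff)
    \<comment> \<open>Otherwise the average of \<open>v\<close> under \<open>T v\<close> would exceed \<open>v\<close> everywhere by a positive constant.\<close>
    have "s \<le> C"
    proof (rule ccontr)
      assume "\<not> s \<le> C"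
      moreover have "v $ y + (s - C) \<le> (T v *v v) $ y" for y
        using \<Lambda>(2)[of y] normalizer_tangent[of v y 0] matrix_vector_mult_diff_distrib[of "T v" 0 v]
        by (simp add: normalizer_zero)
      ultimately show False
        using irreducible_chain.maximum_principle[OF twisted_irreducible, of "s - C" v v] by auto
    qed
    have P\<^sub>0_le: "(P\<^sub>0 *v v) $ y \<le> v $ y + s + C" for y
      using \<Lambda>(1)[of y] normalizer_Jensen[of v y] by linarith
    \<comment> \<open>The same argument for \<open>- v\<close> and the nominal matrix.\<close>
    have "- C \<le> s"
    proof (rule ccontr)
      assume "\<not> - C \<le> s"
      moreover have "(- v) $ y + (- s - C) \<le> (P\<^sub>0 *v (- v)) $ y" for y
        using P\<^sub>0_le[of y] matrix_vector_mult_diff_distrib[of P\<^sub>0 0 v] by simp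
      ultimately show False
        using nominal.maximum_principle[of "- s - C" "- v"] by auto
    qed
    define m where "m = Min (range (($) v))"
    define g where "g = v - vec m"
    have g_nonneg: "0 \<le> g $ y" for y by (simp add: g_def m_def)
    have "m \<in> range (($) v)" unfolding m_def by (rule Min_in) auto
    then obtain z where z: "g $ z = 0" by (auto simp: g_def)
    have "(P\<^sub>0 *v g) $ y \<le> g $ y + 2 * C" for y
      using P\<^sub>0_le[of y] \<open>s \<le> C\<close>
      by (simp add: g_def matrix_vector_mult_diff_distrib nominal.mult_vec)
    hence g_le: "g $ y \<le> b * (2 * C)" for y
      using b(2)[of g "2 * C" y z] g_nonneg C z by simp
    have "v $ x = (g $ x - g $ x\<^sub>0) + s" by (simp add: g_def s_def)
    hence "\<bar>v $ x\<bar> \<le> b * (2 * C) + C"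
      using g_le[of x] g_le[of x\<^sub>0] g_nonneg[of x] g_nonneg[of x\<^sub>0] \<open>s \<le> C\<close> \<open>- C \<le> s\<close> by linarith
    thus ?thesis by (simp add: algebra_simps)
  qed
  thus ?thesis by blast
qed

text \<open>The range is open by invariance of domain, and closed by properness.\<close>

lemma bij_aroe_map: "bij aroe_map"
proof -
  have "open (range aroe_map)"
    using continuous_on_aroe_map inj_aroe_map by (rule invariance_of_domain[OF _ open_UNIV])
  moreover have "closed (range aroe_map)"
    unfolding closed_sequential_limits
  proof (intro allI impI, elim conjE)
    fix f l assume f: "\<forall>n. f n \<in> range aroe_map" and l: "f \<longlonglongrightarrow> l"
    hence "\<forall>n. \<exists>w. f n = aroe_map w" by auto
    then obtain v where v: "\<And>n. f n = aroe_map (v n)" by metis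
    obtain C where C: "\<And>n. norm (f n) \<le> C"
      using l by (metis Bseq_def convergentI convergent_imp_Bseq)
    obtain b where b: "\<forall>w C x. (\<forall>y. \<bar>aroe_map w $ y\<bar> \<le> C) \<longrightarrow> \<bar>w $ x\<bar> \<le> b * C"
      using aroe_map_proper by blast
    have "\<bar>aroe_map (v n) $ y\<bar> \<le> C" for n y
      using C[of n] component_le_norm_cart[of "f n" y] by (simp add: v)
    hence "\<bar>v n $ x\<bar> \<le> b * C" for n x using b by blast
    hence "norm (v n) \<le> (\<Sum>x::'u \<times> 'n\<in>UNIV. b * C)" for n
      by (intro order_trans[OF norm_le_l1_cart] sum_mono)
    hence "bounded (range v)" unfolding bounded_iff by blast
    then obtain w r where r: "strict_mono r" "(v \<circ> r) \<longlonglongrightarrow> w"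
      using bounded_imp_convergent_subsequence by blast
    have "isCont aroe_map w"
      using aroe_map_has_derivative by (rule has_derivative_continuous)
    hence "(\<lambda>n. aroe_map ((v \<circ> r) n)) \<longlonglongrightarrow> aroe_map w"
      using r(2) by (rule isCont_tendsto_compose)
    moreover have "(\<lambda>n. aroe_map ((v \<circ> r) n)) \<longlonglongrightarrow> l"
      using LIMSEQ_subseq_LIMSEQ[OF l r(1)] by (simp add: v o_def)
    ultimately show "l \<in> range aroe_map" using LIMSEQ_unique by blast
  qed
  ultimately have "range aroe_map = UNIV"
    using connected_UNIV by (auto simp: connected_clopen)
  thus ?thesis using inj_aroe_map by (simp add: bij_def)
qed

definition value_curve :: "real \<Rightarrow> real ^ ('u \<times> 'n)" where
  "value_curve \<zeta> = inv aroe_map (\<zeta> *\<^sub>R U)"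

definition normalized_curve :: "real \<Rightarrow> real ^ ('u \<times> 'n)" where
  "normalized_curve \<zeta> = value_curve \<zeta> - vec (value_curve \<zeta> $ x\<^sub>0)"

lemma aroe_map_eq_iff: "aroe_map v = \<zeta> *\<^sub>R U \<longleftrightarrow> v = value_curve \<zeta>"
  unfolding value_curve_def by (rule bij_inv_eq_iff[OF bij_aroe_map, symmetric])

lemma normalized_curve_iff:
  "(\<forall>x. \<zeta> * U $ x + \<Lambda> g x = g $ x + \<eta>) \<and> g $ x\<^sub>0 = 0 \<longleftrightarrow>
     g = normalized_curve \<zeta> \<and> \<eta> = value_curve \<zeta> $ x\<^sub>0"
proof -
  have "(\<forall>x. \<zeta> * U $ x + \<Lambda> g x = g $ x + \<eta>) \<longleftrightarrow> aroe_map (g + vec \<eta>) = \<zeta> *\<^sub>R U"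
    if "g $ x\<^sub>0 = 0"
    using that unfolding aroe_map_shift by (auto simp: aroe_map_def vec_eq_iff algebra_simps)
  hence "(\<forall>x. \<zeta> * U $ x + \<Lambda> g x = g $ x + \<eta>) \<and> g $ x\<^sub>0 = 0 \<longleftrightarrow>
      g + vec \<eta> = value_curve \<zeta> \<and> g $ x\<^sub>0 = 0"
    unfolding aroe_map_eq_iff by blast
  also have "\<dots> \<longleftrightarrow> g = normalized_curve \<zeta> \<and> \<eta> = value_curve \<zeta> $ x\<^sub>0"
  proof
    assume g: "g + vec \<eta> = value_curve \<zeta> \<and> g $ x\<^sub>0 = 0"
    have "value_curve \<zeta> $ x\<^sub>0 = g $ x\<^sub>0 + \<eta>" unfolding conjunct1[OF g, symmetric] by simp
    hence "\<eta> = value_curve \<zeta> $ x\<^sub>0" using g by simp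
    moreover have "g = value_curve \<zeta> - vec \<eta>" using g by (simp add: eq_diff_eq)
    ultimately show "g = normalized_curve \<zeta> \<and> \<eta> = value_curve \<zeta> $ x\<^sub>0"
      by (simp add: normalized_curve_def)
  qed (simp add: normalized_curve_def)
  finally show ?thesis .
qed


section \<open>The differential equation\<close>

text \<open>The Poisson equation says that the vector field is, up to a constant, the image of \<open>U\<close> under
  the inverse of the derivative of \<open>aroe_map\<close>.\<close>

lemma vector_field_Poisson:
  "irreducible_chain.pinned (T h) x\<^sub>0 *v vector_field Q\<^sub>0 R\<^sub>0 U x\<^sub>0 h =
     U - vec (\<Sum>x\<in>UNIV. pmf (invariant_pmf (T h)) x * U $ x)"
proof -
  interpret irreducible_chain "T h" by (rule twisted_irreducible)
  show ?thesis
    using H_circ_Poisson[of U x\<^sub>0] by (simp add: vector_field_def pinned_mult H_circ_base vec_eq_iff)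
qed

lemma vector_field_base: "vector_field Q\<^sub>0 R\<^sub>0 U x\<^sub>0 h $ x\<^sub>0 = 0"
  by (simp add: vector_field_def irreducible_chain.H_circ_base[OF twisted_irreducible])

text \<open>The curve inherits differentiability from the inverse of \<open>aroe_map\<close>.\<close>

lemma normalized_curve_solves_ode: "solves_ode Q\<^sub>0 R\<^sub>0 U x\<^sub>0 normalized_curve"
  unfolding solves_ode_def
proof (intro conjI allI)
  show "normalized_curve 0 = 0"
    using aroe_map_eq_iff[of 0 0] by (simp add: normalized_curve_def aroe_map_zero vec_eq_iff)
next
  fix \<zeta>
  define v where "v = value_curve \<zeta>"
  have T: "T (normalized_curve \<zeta>) = T v"
    using twisted_shift[of "normalized_curve \<zeta>" "v $ x\<^sub>0"] by (simp add: normalized_curve_def v_def)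
  interpret irreducible_chain "T v" by (rule twisted_irreducible)
  obtain N where N: "N ** pinned x\<^sub>0 = mat 1" "pinned x\<^sub>0 ** N = mat 1" by (rule pinned_inverse)
  have "(inv aroe_map has_derivative (\<lambda>k. N *v k)) (at (aroe_map v))"
  proof (rule has_derivative_inverse_strong[where f = aroe_map and S = UNIV])
    show "(\<lambda>k. pinned x\<^sub>0 *v k) \<circ> (\<lambda>k. N *v k) = id"
      by (auto simp: matrix_vector_mul_assoc N)
  qed (use inj_aroe_map in
      \<open>auto intro: continuous_on_aroe_map aroe_map_has_derivative[of v]\<close>)
  moreover have "aroe_map v = \<zeta> *\<^sub>R U" by (simp add: aroe_map_eq_iff v_def)
  moreover have "((\<lambda>\<zeta>. \<zeta> *\<^sub>R U) has_derivative (\<lambda>t. t *\<^sub>R U)) (at \<zeta>)"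
    by (auto intro!: derivative_eq_intros)
  ultimately have "((\<lambda>\<zeta>. inv aroe_map (\<zeta> *\<^sub>R U)) has_derivative (\<lambda>t. N *v (t *\<^sub>R U))) (at \<zeta>)"
    by (metis has_derivative_compose)
  hence deriv: "(value_curve has_vector_derivative N *v U) (at \<zeta>)"
    by (simp add: has_vector_derivative_def value_curve_def[abs_def] matrix_vector_mult_scaleR)
  define L :: "real ^ ('u \<times> 'n) \<Rightarrow> real ^ ('u \<times> 'n)" where "L w = w - vec (w $ x\<^sub>0)" for w
  have "linear L" by (rule linearI) (auto simp: L_def vec_eq_iff algebra_simps)
  hence "((\<lambda>\<zeta>. L (value_curve \<zeta>)) has_vector_derivative L (N *v U)) (at \<zeta>)"
    by (intro bounded_linear.has_vector_derivative[OF _ deriv])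
      (simp add: linear_conv_bounded_linear)
  moreover have "L (N *v U) = vector_field Q\<^sub>0 R\<^sub>0 U x\<^sub>0 (normalized_curve \<zeta>)"
  proof -
    define c where "c = (\<Sum>x\<in>UNIV. pmf (invariant_pmf (T v)) x * U $ x)"
    define H where "H = vector_field Q\<^sub>0 R\<^sub>0 U x\<^sub>0 (normalized_curve \<zeta>)"
    have "pinned x\<^sub>0 *v vec c = vec c" by (simp add: pinned_mult mult_vec)
    hence "pinned x\<^sub>0 *v (H + vec c) = U"
      using vector_field_Poisson[of "normalized_curve \<zeta>"]
      by (simp add: matrix_vector_right_distrib T H_def c_def)
    hence "N *v U = H + vec c"
      by (metis N(1) matrix_vector_mul_assoc matrix_vector_mul_lid)
    thus ?thesis by (simp add: L_def H_def vector_field_base vec_eq_iff)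
  qed
  ultimately show "(normalized_curve has_vector_derivative
      vector_field Q\<^sub>0 R\<^sub>0 U x\<^sub>0 (normalized_curve \<zeta>)) (at \<zeta>)"
    by (simp add: L_def normalized_curve_def[abs_def])
qed

text \<open>Along a solution, \<open>aroe_map h - \<zeta> U\<close> has a derivative that is a constant vector, so it stays a
  constant vector, and adding a constant to \<open>h\<close> makes the optimality equation hold.\<close>

lemma ode_solution_unique:
  assumes "solves_ode Q\<^sub>0 R\<^sub>0 U x\<^sub>0 h"
  shows "h = normalized_curve"
proof
  fix \<zeta>
  have h0: "h 0 = 0"
    and h': "\<And>\<zeta>. (h has_vector_derivative vector_field Q\<^sub>0 R\<^sub>0 U x\<^sub>0 (h \<zeta>)) (at \<zeta>)"
    using assms by (auto simp: solves_ode_def)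
  define G where "G \<zeta> = aroe_map (h \<zeta>) - \<zeta> *\<^sub>R U" for \<zeta>
  define c where "c \<zeta> = (\<Sum>x\<in>UNIV. pmf (invariant_pmf (T (h \<zeta>))) x * U $ x)" for \<zeta>
  have "((\<lambda>\<zeta>. aroe_map (h \<zeta>)) has_vector_derivative U - vec (c \<zeta>)) (at \<zeta>)" for \<zeta>
    using has_derivative_compose[OF h'[unfolded has_vector_derivative_def] aroe_map_has_derivative]
    by (simp add: has_vector_derivative_def matrix_vector_mult_scaleR vector_field_Poisson c_def)
  hence G': "(G has_vector_derivative - vec (c \<zeta>)) (at \<zeta>)" for \<zeta>
    unfolding G_def by (auto intro!: derivative_eq_intros)
  have G0: "G 0 = 0" by (simp add: G_def h0 aroe_map_zero)
  have "G \<zeta> $ x = G \<zeta> $ x\<^sub>0" for x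
  proof -
    have "((\<lambda>\<zeta>. G \<zeta> $ x - G \<zeta> $ x\<^sub>0) has_vector_derivative 0) (at \<zeta>)" for \<zeta>
      using has_vector_derivative_diff
        [OF bounded_linear.has_vector_derivative[OF bounded_linear_vec_nth G', of x \<zeta>]
            bounded_linear.has_vector_derivative[OF bounded_linear_vec_nth G', of x\<^sub>0 \<zeta>]] by simp
    hence "((\<lambda>\<zeta>. G \<zeta> $ x - G \<zeta> $ x\<^sub>0) has_real_derivative 0) (at \<zeta>)" for \<zeta>
      by (simp add: has_real_derivative_iff_has_vector_derivative)
    hence "G \<zeta> $ x - G \<zeta> $ x\<^sub>0 = G 0 $ x - G 0 $ x\<^sub>0" by (rule DERIV_isconst_all[rule_format])
    thus ?thesis by (simp add: G0)
  qed
  hence "aroe_map (h \<zeta>) = \<zeta> *\<^sub>R U + vec (G \<zeta> $ x\<^sub>0)"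
    by (simp add: G_def vec_eq_iff algebra_simps)
  moreover have "h \<zeta> $ x\<^sub>0 = 0"
  proof -
    have "((\<lambda>\<zeta>. h \<zeta> $ x\<^sub>0) has_vector_derivative 0) (at \<zeta>)" for \<zeta>
      using bounded_linear.has_vector_derivative[OF bounded_linear_vec_nth h', of x\<^sub>0 \<zeta>]
      by (simp add: vector_field_base)
    hence "((\<lambda>\<zeta>. h \<zeta> $ x\<^sub>0) has_real_derivative 0) (at \<zeta>)" for \<zeta>
      by (simp add: has_real_derivative_iff_has_vector_derivative)
    hence "h \<zeta> $ x\<^sub>0 = h 0 $ x\<^sub>0" by (rule DERIV_isconst_all[rule_format])
    thus ?thesis by (simp add: h0)
  qed
  ultimately have "(\<forall>x. \<zeta> * U $ x + \<Lambda> (h \<zeta>) x = h \<zeta> $ x + - (G \<zeta> $ x\<^sub>0)) \<and> h \<zeta> $ x\<^sub>0 = 0"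
    by (simp add: aroe_map_def vec_eq_iff algebra_simps)
  thus "h \<zeta> = normalized_curve \<zeta>" using normalized_curve_iff by blast
qed


section \<open>Optimal decision rules and optimal average reward\<close>

lemma kl_cost_real:
  fixes R defines "P \<equiv> transition_matrix Q\<^sub>0 R"
  assumes ac: "\<And>y. P $ x $ y > 0 \<Longrightarrow> P\<^sub>0 $ x $ y > 0"
  shows "kl_cost Q\<^sub>0 R\<^sub>0 x R = ereal (row_divergence (P $ x) (P\<^sub>0 $ x))"
proof -
  have "rel_entropy_term (P $ x $ y) (P\<^sub>0 $ x $ y) =
      ereal (P $ x $ y * ln (P $ x $ y / P\<^sub>0 $ x $ y))" for y
    using ac by (intro rel_entropy_term_real) (auto simp: P_def transition_matrix_nonneg)
  thus ?thesis by (simp add: kl_cost_def row_divergence_def P_def)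
qed

lemma not_absolutely_continuousD:
  assumes "\<not> (\<forall>y. transition_matrix Q\<^sub>0 R $ x $ y > 0 \<longrightarrow> P\<^sub>0 $ x $ y > 0)"
  obtains y where "rel_entropy_term (transition_matrix Q\<^sub>0 R $ x $ y) (P\<^sub>0 $ x $ y) = \<infinity>"
proof -
  obtain y where y: "transition_matrix Q\<^sub>0 R $ x $ y > 0" "\<not> P\<^sub>0 $ x $ y > 0"
    using assms by blast
  hence "P\<^sub>0 $ x $ y = 0" using transition_matrix_nonneg[of Q\<^sub>0 R\<^sub>0 x y] by linarith
  thus ?thesis using that[OF rel_entropy_term_infinite] y by blast
qed

lemma kl_cost_infinite:
  assumes "\<not> (\<forall>y. transition_matrix Q\<^sub>0 R $ x $ y > 0 \<longrightarrow> P\<^sub>0 $ x $ y > 0)"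
  shows "kl_cost Q\<^sub>0 R\<^sub>0 x R = \<infinity>"
  unfolding kl_cost_def sum_Pinfty
  using not_absolutely_continuousD[OF assms] by (metis UNIV_I finite)

text \<open>A decision rule that is not absolutely continuous at \<open>x\<close> earns \<open>-\<infinity>\<close>; for the others the gap
  to the bound is the divergence from the twisted row.\<close>

lemma aroe_objective_bound:
  "aroe_objective Q\<^sub>0 R\<^sub>0 U \<zeta> h x R \<le> ereal (\<zeta> * U $ x + \<Lambda> h x)" (is "?le")
  "aroe_objective Q\<^sub>0 R\<^sub>0 U \<zeta> h x R = ereal (\<zeta> * U $ x + \<Lambda> h x) \<longleftrightarrow>
     transition_matrix Q\<^sub>0 R $ x = T h $ x" (is "?eq")
proof -
  define P where "P = transition_matrix Q\<^sub>0 R"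
  have "?le \<and> ?eq"
  proof (cases "\<forall>y. P $ x $ y > 0 \<longrightarrow> P\<^sub>0 $ x $ y > 0")
    case True
    hence ac: "P $ x $ y > 0 \<Longrightarrow> P\<^sub>0 $ x $ y > 0" for y by blast
    have "aroe_objective Q\<^sub>0 R\<^sub>0 U \<zeta> h x R =
        ereal (\<zeta> * U $ x - row_divergence (P $ x) (P\<^sub>0 $ x) + (P *v h) $ x)"
      using kl_cost_real[of R x] ac
      by (simp add: aroe_objective_def one_step_reward_def P_def matrix_vector_mult_def)
    thus ?thesis
      using divergence_from_twisted[of R x h] divergence_from_twisted_nonneg[of R x h] ac
      by (auto simp: P_def)
  next
    case False
    hence "aroe_objective Q\<^sub>0 R\<^sub>0 U \<zeta> h x R = -\<infinity>"
      using kl_cost_infinite[of R x]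
      by (simp add: aroe_objective_def one_step_reward_def P_def)
    moreover have "P $ x \<noteq> T h $ x" using False twisted_pos_iff[of h x] by metis
    ultimately show ?thesis by (simp add: P_def)
  qed
  thus ?le ?eq by auto
qed

lemma is_arg_max_aroe_objective:
  "is_arg_max (aroe_objective Q\<^sub>0 R\<^sub>0 U \<zeta> h x) (\<lambda>_. True) R \<longleftrightarrow>
     transition_matrix Q\<^sub>0 R $ x = T h $ x"
proof -
  obtain R' where "T h = transition_matrix Q\<^sub>0 R'" by (rule twisted_admissible)
  hence "aroe_objective Q\<^sub>0 R\<^sub>0 U \<zeta> h x R' = ereal (\<zeta> * U $ x + \<Lambda> h x)"
    by (simp add: aroe_objective_bound)
  thus ?thesis
    unfolding is_arg_max_def aroe_objective_bound(2)[of \<zeta> h x R, symmetric]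
    by (metis aroe_objective_bound(1) antisym not_less)
qed

lemma solves_aroe_iff:
  "solves_aroe Q\<^sub>0 R\<^sub>0 U \<zeta> h (ereal \<eta>) \<longleftrightarrow> (\<forall>x. \<zeta> * U $ x + \<Lambda> h x = h $ x + \<eta>)"
proof -
  obtain R where "T h = transition_matrix Q\<^sub>0 R" by (rule twisted_admissible)
  hence "solves_aroe Q\<^sub>0 R\<^sub>0 U \<zeta> h (ereal \<eta>) \<longleftrightarrow>
      (\<forall>x. ereal (\<zeta> * U $ x + \<Lambda> h x) = ereal (h $ x) + ereal \<eta>)"
    unfolding solves_aroe_def is_arg_max_aroe_objective
    by (metis aroe_objective_bound(2))
  thus ?thesis by simp
qed

text \<open>Averaging the optimality equation over an invariant \<open>\<pi>\<close> cancels \<open>h\<close> against \<open>P h\<close> and leaves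
  \<open>\<eta>\<close> minus the averaged divergence from the twisted rows. Equality forces \<open>P\<close> and the
  twisted matrix to agree on the support of \<open>\<pi>\<close>, and by irreducibility this is everything.\<close>

lemma steady_state_reward_bound:
  assumes adm: "admissible_pair Q\<^sub>0 (P, \<pi>)"
    and eq: "\<And>x. \<zeta> * U $ x + \<Lambda> h x = h $ x + \<eta>"
  shows "steady_state_reward P\<^sub>0 U \<zeta> (P, \<pi>) \<le> ereal \<eta>" (is "?le")
    and "steady_state_reward P\<^sub>0 U \<zeta> (P, \<pi>) = ereal \<eta> \<longleftrightarrow> P = T h" (is "?eq")
proof -
  obtain R where P: "P = transition_matrix Q\<^sub>0 R" and inv: "invariant_for P \<pi>"
    using adm by (auto simp: admissible_pair_def)
  have "?le \<and> ?eq"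
  proof (cases "\<forall>x. pmf \<pi> x > 0 \<longrightarrow> (\<forall>y. P $ x $ y > 0 \<longrightarrow> P\<^sub>0 $ x $ y > 0)")
    case True
    have "kl_rate P P\<^sub>0 \<pi> = (\<Sum>x\<in>UNIV. \<Sum>y\<in>UNIV.
        ereal (pmf \<pi> x * (P $ x $ y * ln (P $ x $ y / P\<^sub>0 $ x $ y))))"
      unfolding kl_rate_def
    proof (intro sum.cong refl)
      fix x y
      show "ereal (pmf \<pi> x) * rel_entropy_term (P $ x $ y) (P\<^sub>0 $ x $ y) =
          ereal (pmf \<pi> x * (P $ x $ y * ln (P $ x $ y / P\<^sub>0 $ x $ y)))"
      proof (cases "pmf \<pi> x = 0")
        case False
        hence "pmf \<pi> x > 0" by (simp add: less_le)
        hence "rel_entropy_term (P $ x $ y) (P\<^sub>0 $ x $ y) =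
            ereal (P $ x $ y * ln (P $ x $ y / P\<^sub>0 $ x $ y))"
          using True by (intro rel_entropy_term_real) (simp_all add: P transition_matrix_nonneg)
        thus ?thesis by simp
      qed (simp flip: zero_ereal_def)
    qed
    also have "\<dots> = ereal (\<Sum>x\<in>UNIV. pmf \<pi> x * row_divergence (P $ x) (P\<^sub>0 $ x))"
      by (simp add: row_divergence_def sum_distrib_left)
    finally have "steady_state_reward P\<^sub>0 U \<zeta> (P, \<pi>) = ereal (\<zeta> * (\<Sum>x\<in>UNIV. pmf \<pi> x * U $ x)
        - (\<Sum>x\<in>UNIV. pmf \<pi> x * row_divergence (P $ x) (P\<^sub>0 $ x)))"
      by (simp add: steady_state_reward_def)
    also have "\<zeta> * (\<Sum>x\<in>UNIV. pmf \<pi> x * U $ x)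
        - (\<Sum>x\<in>UNIV. pmf \<pi> x * row_divergence (P $ x) (P\<^sub>0 $ x)) =
        (\<Sum>x\<in>UNIV. pmf \<pi> x * h $ x - pmf \<pi> x * (P *v h) $ x + pmf \<pi> x * \<eta>
           - pmf \<pi> x * row_divergence (P $ x) (T h $ x))"
      unfolding sum_distrib_left sum_subtractf[symmetric]
    proof (intro sum.cong refl)
      fix x
      show "\<zeta> * (pmf \<pi> x * U $ x) - pmf \<pi> x * row_divergence (P $ x) (P\<^sub>0 $ x) =
          pmf \<pi> x * h $ x - pmf \<pi> x * (P *v h) $ x + pmf \<pi> x * \<eta>
           - pmf \<pi> x * row_divergence (P $ x) (T h $ x)"
      proof (cases "pmf \<pi> x = 0")
        case False
        hence "pmf \<pi> x > 0" by (simp add: less_le)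
        hence "row_divergence (P $ x) (T h $ x) =
            row_divergence (P $ x) (P\<^sub>0 $ x) - (P *v h) $ x + \<Lambda> h x"
          using True unfolding P by (intro divergence_from_twisted) auto
        moreover have "\<zeta> * U $ x = h $ x + \<eta> - \<Lambda> h x" using eq[of x] by simp
        ultimately have "\<zeta> * U $ x - row_divergence (P $ x) (P\<^sub>0 $ x) =
            h $ x - (P *v h) $ x + \<eta> - row_divergence (P $ x) (T h $ x)" by simp
        hence "pmf \<pi> x * (\<zeta> * U $ x - row_divergence (P $ x) (P\<^sub>0 $ x)) =
            pmf \<pi> x * (h $ x - (P *v h) $ x + \<eta> - row_divergence (P $ x) (T h $ x))" by simp
        thus ?thesis by (simp add: algebra_simps)
      qed simp
    qed
    also have "\<dots> = \<eta> - (\<Sum>x\<in>UNIV. pmf \<pi> x * row_divergence (P $ x) (T h $ x))"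
    proof -
      have "(\<Sum>x\<in>UNIV. pmf \<pi> x * (P *v h) $ x) = inner (pmf_vec \<pi> v* P) h"
        unfolding dot_lmul_matrix by (simp add: inner_vec_def pmf_vec_def)
      also have "\<dots> = (\<Sum>x\<in>UNIV. pmf \<pi> x * h $ x)"
        using inv by (simp add: invariant_for_def inner_vec_def pmf_vec_def)
      finally show ?thesis
        by (simp add: sum.distrib sum_subtractf sum_pmf_eq_1 flip: sum_distrib_right)
    qed
    finally have reward: "steady_state_reward P\<^sub>0 U \<zeta> (P, \<pi>) =
        ereal (\<eta> - (\<Sum>x\<in>UNIV. pmf \<pi> x * row_divergence (P $ x) (T h $ x)))" .
    have div: "0 \<le> row_divergence (P $ x) (T h $ x) \<and>
        (row_divergence (P $ x) (T h $ x) = 0 \<longleftrightarrow> P $ x = T h $ x)" if "pmf \<pi> x > 0" for x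
      using True that divergence_from_twisted_nonneg[of R x h] unfolding P by blast
    have terms: "0 \<le> pmf \<pi> x * row_divergence (P $ x) (T h $ x)" for x
      using div[of x] by (cases "pmf \<pi> x = 0") (auto simp: less_le)
    have "P = T h" if "(\<Sum>x\<in>UNIV. pmf \<pi> x * row_divergence (P $ x) (T h $ x)) = 0"
    proof -
      have "\<forall>x\<in>UNIV. pmf \<pi> x * row_divergence (P $ x) (T h $ x) = 0"
        using that terms by (subst (asm) sum_nonneg_eq_0_iff) auto
      hence rows: "pmf \<pi> x > 0 \<Longrightarrow> P $ x = T h $ x" for x
        using div[of x] by (metis UNIV_I less_irrefl mult_eq_0_iff)
      have "pmf \<pi> x > 0" for x
        by (rule irreducible_chain.invariant_full_support[OF twisted_irreducible inv _ rows])
          (simp_all add: P transition_matrix_nonneg)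
      thus ?thesis using rows by (simp add: vec_eq_iff)
    qed
    moreover have "(\<Sum>x\<in>UNIV. pmf \<pi> x * row_divergence (P $ x) (T h $ x)) = 0" if "P = T h"
      using div that by (intro sum.neutral) (force simp: less_le)
    moreover have "0 \<le> (\<Sum>x\<in>UNIV. pmf \<pi> x * row_divergence (P $ x) (T h $ x))"
      using terms by (intro sum_nonneg) auto
    ultimately show ?thesis unfolding reward by auto
  next
    case False
    then obtain x where x: "pmf \<pi> x > 0"
      and nac: "\<not> (\<forall>y. P $ x $ y > 0 \<longrightarrow> P\<^sub>0 $ x $ y > 0)" by blast
    obtain y where "rel_entropy_term (P $ x $ y) (P\<^sub>0 $ x $ y) = \<infinity>"
      using not_absolutely_continuousD nac unfolding P by blast
    hence "ereal (pmf \<pi> x) * rel_entropy_term (P $ x $ y) (P\<^sub>0 $ x $ y) = \<infinity>" using x by simp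
    hence "kl_rate P P\<^sub>0 \<pi> = \<infinity>"
      unfolding kl_rate_def by (auto simp: sum_Pinfty)
    hence "steady_state_reward P\<^sub>0 U \<zeta> (P, \<pi>) = -\<infinity>" by (simp add: steady_state_reward_def)
    moreover have "P \<noteq> T h" using nac twisted_pos_iff[of h x] by metis
    ultimately show ?thesis by simp
  qed
  thus ?le ?eq by auto
qed

lemma twisted_admissible_pair: "admissible_pair Q\<^sub>0 (T h, invariant_pmf (T h))"
  using irreducible_chain.invariant_pmf[OF twisted_irreducible] twisted_admissible
  unfolding admissible_pair_def by blast

lemma optimal_average_reward_eq:
  assumes "\<And>x. \<zeta> * U $ x + \<Lambda> h x = h $ x + \<eta>"
  shows "optimal_average_reward Q\<^sub>0 R\<^sub>0 U \<zeta> = ereal \<eta>"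
  unfolding optimal_average_reward_def
proof (rule antisym)
  show "(SUP p\<in>{p. admissible_pair Q\<^sub>0 p}. steady_state_reward P\<^sub>0 U \<zeta> p) \<le> ereal \<eta>"
    using steady_state_reward_bound(1)[OF _ assms] by (intro SUP_least) auto
  show "ereal \<eta> \<le> (SUP p\<in>{p. admissible_pair Q\<^sub>0 p}. steady_state_reward P\<^sub>0 U \<zeta> p)"
    using steady_state_reward_bound(2)[OF twisted_admissible_pair[of h] assms]
      twisted_admissible_pair[of h]
    by (intro SUP_upper2[of "(T h, invariant_pmf (T h))"]) simp_all
qed

lemma is_arg_max_steady_state_reward:
  assumes "\<And>x. \<zeta> * U $ x + \<Lambda> h x = h $ x + \<eta>"
  shows "(\<exists>\<pi>. is_arg_max (steady_state_reward P\<^sub>0 U \<zeta>) (admissible_pair Q\<^sub>0) (P, \<pi>)) \<longleftrightarrow> P = T h"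
proof -
  have max: "steady_state_reward P\<^sub>0 U \<zeta> p \<le> ereal \<eta>" if "admissible_pair Q\<^sub>0 p" for p
    using steady_state_reward_bound(1)[OF _ assms, of "fst p" "snd p"] that by simp
  have attained: "steady_state_reward P\<^sub>0 U \<zeta> (T h, invariant_pmf (T h)) = ereal \<eta>"
    using steady_state_reward_bound(2)[OF twisted_admissible_pair assms] by simp
  have "is_arg_max (steady_state_reward P\<^sub>0 U \<zeta>) (admissible_pair Q\<^sub>0) (P, \<pi>) \<longleftrightarrow>
      admissible_pair Q\<^sub>0 (P, \<pi>) \<and> P = T h" for \<pi>
  proof
    assume *: "is_arg_max (steady_state_reward P\<^sub>0 U \<zeta>) (admissible_pair Q\<^sub>0) (P, \<pi>)"
    hence adm: "admissible_pair Q\<^sub>0 (P, \<pi>)" by (simp add: is_arg_max_def)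
    have "\<not> steady_state_reward P\<^sub>0 U \<zeta> (P, \<pi>) < ereal \<eta>"
      using * attained twisted_admissible_pair[of h] unfolding is_arg_max_def by force
    hence "steady_state_reward P\<^sub>0 U \<zeta> (P, \<pi>) = ereal \<eta>"
      using max[OF adm] by (simp add: not_less)
    thus "admissible_pair Q\<^sub>0 (P, \<pi>) \<and> P = T h"
      using steady_state_reward_bound(2)[OF adm assms] adm by simp
  next
    assume *: "admissible_pair Q\<^sub>0 (P, \<pi>) \<and> P = T h"
    hence "steady_state_reward P\<^sub>0 U \<zeta> (P, \<pi>) = ereal \<eta>"
      using steady_state_reward_bound(2)[of P \<pi>, OF _ assms] by blast
    thus "is_arg_max (steady_state_reward P\<^sub>0 U \<zeta>) (admissible_pair Q\<^sub>0) (P, \<pi>)"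
      using * max unfolding is_arg_max_def by (metis not_less)
  qed
  thus ?thesis using twisted_admissible_pair by blast
qed

lemma normalized_curve_aroe:
  "\<zeta> * U $ x + \<Lambda> (normalized_curve \<zeta>) x = normalized_curve \<zeta> $ x + value_curve \<zeta> $ x\<^sub>0"
  using normalized_curve_iff[of \<zeta> "normalized_curve \<zeta>" "value_curve \<zeta> $ x\<^sub>0"] by simp

lemma relative_value_function_iff:
  "relative_value_function Q\<^sub>0 R\<^sub>0 U x\<^sub>0 \<zeta> g \<longleftrightarrow> g = normalized_curve \<zeta>"
  unfolding relative_value_function_def optimal_average_reward_eq[OF normalized_curve_aroe]
    solves_aroe_iff normalized_curve_iff by simp

lemma optimal_transition_matrix_iff:
  "optimal_transition_matrix Q\<^sub>0 R\<^sub>0 U x\<^sub>0 \<zeta> P \<longleftrightarrow> P = T (normalized_curve \<zeta>)"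
proof -
  obtain R where "T (normalized_curve \<zeta>) = transition_matrix Q\<^sub>0 R" by (rule twisted_admissible)
  moreover have "(\<forall>x. M $ x = N $ x) \<longleftrightarrow> M = N" for M N :: "real ^ ('u \<times> 'n) ^ ('u \<times> 'n)"
    by (simp add: vec_eq_iff)
  ultimately show ?thesis
    unfolding optimal_transition_matrix_def relative_value_function_iff is_arg_max_aroe_objective
    by auto
qed

end

theorem theorem2p4:
  fixes R\<^sub>0 :: "('u::finite \<times> 'n::finite) \<Rightarrow> 'u pmf"
    and Q\<^sub>0 :: "'u \<times> 'n \<Rightarrow> 'n pmf"
    and U :: "real ^ ('u \<times> 'n)"
    and x\<^sub>0 :: "'u \<times> 'n"
  assumes "irreducible_matrix (transition_matrix Q\<^sub>0 R\<^sub>0)"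
    and "aperiodic_matrix (transition_matrix Q\<^sub>0 R\<^sub>0)"
  shows "(\<exists>!h. solves_ode Q\<^sub>0 R\<^sub>0 U x\<^sub>0 h) \<and>
    (\<forall>h. solves_ode Q\<^sub>0 R\<^sub>0 U x\<^sub>0 h \<longrightarrow>
      (\<forall>\<zeta>. (\<forall>g. relative_value_function Q\<^sub>0 R\<^sub>0 U x\<^sub>0 \<zeta> g \<longleftrightarrow> g = h \<zeta>) \<and>
           (\<forall>P. optimal_transition_matrix Q\<^sub>0 R\<^sub>0 U x\<^sub>0 \<zeta> P \<longleftrightarrow> P = twisted_matrix Q\<^sub>0 R\<^sub>0 (h \<zeta>)) \<and>
           (\<forall>P. (\<exists>\<pi>. is_arg_max (steady_state_reward (transition_matrix Q\<^sub>0 R\<^sub>0) U \<zeta>)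
                       (admissible_pair Q\<^sub>0) (P, \<pi>)) \<longleftrightarrow> P = twisted_matrix Q\<^sub>0 R\<^sub>0 (h \<zeta>))))"
proof -
  interpret controlled_chain Q\<^sub>0 R\<^sub>0 U x\<^sub>0 using assms(1) by unfold_locales
  have "solves_ode Q\<^sub>0 R\<^sub>0 U x\<^sub>0 h \<longleftrightarrow> h = normalized_curve" for h
    using normalized_curve_solves_ode ode_solution_unique by blast
  thus ?thesis
    by (simp add: relative_value_function_iff optimal_transition_matrix_iff
        is_arg_max_steady_state_reward[OF normalized_curve_aroe])
qed

end
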